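(* Let $p\in(1,\infty)$ and let $\Psi:(0,\infty)\to(0,\infty)$ be a scale function which satisfies $$C^{-1}\left(\frac{R}{r}\right)^{\beta_L}\le\frac{\Psi(R)}{\Psi(r)}\le C\left(\frac{R}{r}\right)^{\beta_U}\qquad\text{for all } 0<r\le R<\infty$$ for some $C\ge1$ and some exponents $p\le\beta_L\le\beta_U$. Then there exist doubling measures $\nu_1$ and $\nu_2$ on $[0,1]$, both of which are non-atomic Radon probability measures with full topological support, such that the Poincaré inequality $\mathrm{PI}_p(\Psi)$ and the annular capacity upper estimate $\mathrm{Cap}_p(\Psi)$ hold for the $p$-energy form $(\mathcal{E},\mathcal{F})$ defined with $\Lambda=\nu_1$ and $\mu=\nu_2$.
   Context: A scale function is an increasing homeomorphism $\Psi:(0,\infty)\to(0,\infty)$ for which there are $1<\beta_L\le\beta_U$ and $C\ge1$ such that $C^{-1}(R/r)^{\beta_L}\le\Psi(R)/\Psi(r)\le C(R/r)^{\beta_U}$ for all $0<r\le R<\infty$. Balls are $B(x,r):=\{y\in[0,1]:|x-y|<r\}$. A Radon measure $\nu$ on $[0,1]$ is doubling if there is $D>0$ with $0<\nu(B(x,2r))\le D\,\nu(B(x,r))$ for all $x\in[0,1]$, $r>0$. $p$-energy form: let $\Lambda,\mu$ be non-atomic Radon probability measures on $[0,1]$ with full topological support. Put $\mathscr{U}(x):=\Lambda([0,x])$, an increasing homeomorphism of $[0,1]$. Let $W^{1,p}$ be the first-order Sobolev space on $(0,1)$, its elements being identified with their absolutely continuous representatives on $[0,1]$, with weak derivative $\nabla$.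 The domain $\mathcal{F}$ is the set of continuous $f:[0,1]\to\mathbb{R}$ with $f\circ\mathscr{U}^{-1}\in W^{1,p}$, and $\mathcal{E}(f):=\int_0^1|\nabla(f\circ\mathscr{U}^{-1})|^p\,\mathrm{d}x$. For $f\in\mathcal{F}$, $\mathrm{D}f:=(\nabla(f\circ\mathscr{U}^{-1}))\circ\mathscr{U}\in L^p(\Lambda)$. $\mathrm{PI}_p(\Psi)$: there is $C>0$ such that for every $f\in\mathcal{F}$, $x\in[0,1]$, $r>0$, $$\inf_{c\in\mathbb{R}}\int_{B(x,r)}|f-c|^p\,\mathrm{d}\mu\le C\,\Psi(r)\int_{B(x,r)}|\mathrm{D}f|^p\,\mathrm{d}\Lambda.$$ $\mathrm{Cap}_p(\Psi)$: there is $C>0$ such that for every $x\in[0,1]$ and $r>0$ there is $\varphi\in\mathcal{F}$ with $\varphi=1$ on $B(x,r)$, $\varphi=0$ on $[0,1]\setminus B(x,2r)$ and $$\mathcal{E}(\varphi)\le C\,\frac{\mu(B(x,r))}{\Psi(r)}.$$ *)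

theory Defs
  imports "HOL-Probability.Probability"
begin

section \<open>Scale functions\<close>

definition scale_bounds :: "(real \<Rightarrow> real) \<Rightarrow> real \<Rightarrow> real \<Rightarrow> real \<Rightarrow> bool" where
  "scale_bounds \<Psi> C \<beta>L \<beta>U \<longleftrightarrow>
     (\<forall>r R. 0 < r \<and> r \<le> R \<longrightarrow>
        inverse C * (R / r) powr \<beta>L \<le> \<Psi> R / \<Psi> r \<and> \<Psi> R / \<Psi> r \<le> C * (R / r) powr \<beta>U)"

definition scale_function :: "(real \<Rightarrow> real) \<Rightarrow> bool" where
  "scale_function \<Psi> \<longleftrightarrow>
     strict_mono_on {0<..} \<Psi> \<and> (\<exists>\<Phi>. homeomorphism {0<..} {0<..} \<Psi> \<Phi>) \<and>
     (\<exists>C \<beta>L \<beta>U. 1 < \<beta>L \<and> \<beta>L \<le> \<beta>U \<and> 1 \<le> C \<and> scale_bounds \<Psi> C \<beta>L \<beta>U)"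

section \<open>Measures on the unit interval\<close>

text \<open>A measure on \<open>[0,1]\<close> has \<open>space \<nu> = {0..1}\<close>, and its measurable sets are the Borel subsets
  of \<open>[0,1]\<close>. Functions on \<open>[0,1]\<close> are represented by functions on the reals whose values outside
  \<open>[0,1]\<close> play no role.\<close>

definition radon01 :: "real measure \<Rightarrow> bool" where
  "radon01 \<nu> \<longleftrightarrow>
     sets \<nu> = sets (restrict_space borel {0..1}) \<and>
     (\<forall>K. compact K \<and> K \<subseteq> {0..1} \<longrightarrow> emeasure \<nu> K < \<infinity>) \<and>
     (\<forall>A\<in>sets \<nu>. emeasure \<nu> A = (SUP K\<in>{K. compact K \<and> K \<subseteq> A}. emeasure \<nu> K))"

definition nonatomic :: "'a measure \<Rightarrow> bool" where
  "nonatomic \<nu> \<longleftrightarrow>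
     \<not> (\<exists>A\<in>sets \<nu>. emeasure \<nu> A > 0 \<and>
          (\<forall>B\<in>sets \<nu>. B \<subseteq> A \<and> emeasure \<nu> B < emeasure \<nu> A \<longrightarrow> emeasure \<nu> B = 0))"

definition full_support01 :: "real measure \<Rightarrow> bool" where
  "full_support01 \<nu> \<longleftrightarrow>
     (\<forall>V. open V \<and> V \<inter> {0..1} \<noteq> {} \<longrightarrow> emeasure \<nu> (V \<inter> {0..1}) > 0)"

definition admissible01 :: "real measure \<Rightarrow> bool" where
  "admissible01 \<nu> \<longleftrightarrow> radon01 \<nu> \<and> prob_space \<nu> \<and> nonatomic \<nu> \<and> full_support01 \<nu>"

definition ball01 :: "real \<Rightarrow> real \<Rightarrow> real set" where
  "ball01 x r = {y \<in> {0..1}. \<bar>x - y\<bar> < r}"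

definition doubling01 :: "real measure \<Rightarrow> bool" where
  "doubling01 \<nu> \<longleftrightarrow> radon01 \<nu> \<and>
     (\<exists>D>0. \<forall>x\<in>{0..1}. \<forall>r>0.
        0 < measure \<nu> (ball01 x (2 * r)) \<and>
        measure \<nu> (ball01 x (2 * r)) \<le> D * measure \<nu> (ball01 x r))"

section \<open>The Sobolev space on the open unit interval\<close>

definition Lp01 :: "real \<Rightarrow> (real \<Rightarrow> real) \<Rightarrow> bool" where
  "Lp01 p h \<longleftrightarrow>
     set_borel_measurable lborel {0<..<1} h \<and>
     set_integrable lborel {0<..<1} (\<lambda>x. \<bar>h x\<bar> powr p)"

definition L1_loc01 :: "(real \<Rightarrow> real) \<Rightarrow> bool" where
  "L1_loc01 h \<longleftrightarrow> (\<forall>K. compact K \<and> K \<subseteq> {0<..<1} \<longrightarrow> set_integrable lborel K h)"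

definition test_function01 :: "(real \<Rightarrow> real) \<Rightarrow> bool" where
  "test_function01 \<eta> \<longleftrightarrow>
     (\<forall>k x. ((deriv ^^ k) \<eta>) field_differentiable (at x)) \<and>
     closure {x. \<eta> x \<noteq> 0} \<subseteq> {0<..<1}"

definition has_weak_deriv01 :: "(real \<Rightarrow> real) \<Rightarrow> (real \<Rightarrow> real) \<Rightarrow> bool" where
  "has_weak_deriv01 h g \<longleftrightarrow> L1_loc01 h \<and> L1_loc01 g \<and>
     (\<forall>\<eta>. test_function01 \<eta> \<longrightarrow>
        (LINT x:{0<..<1}|lborel. h x * deriv \<eta> x) = - (LINT x:{0<..<1}|lborel. g x * \<eta> x))"

definition sobolev01 :: "real \<Rightarrow> (real \<Rightarrow> real) \<Rightarrow> bool" where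
  "sobolev01 p h \<longleftrightarrow> Lp01 p h \<and> (\<exists>g. has_weak_deriv01 h g \<and> Lp01 p g)"

text \<open>The weak derivative is unique up to Lebesgue-null sets; one version is selected.\<close>

definition weak_deriv01 :: "(real \<Rightarrow> real) \<Rightarrow> real \<Rightarrow> real" where
  "weak_deriv01 h = (SOME g. has_weak_deriv01 h g)"

section \<open>The energy form\<close>

definition scaleU :: "real measure \<Rightarrow> real \<Rightarrow> real" where
  "scaleU \<Lambda> x = measure \<Lambda> {0..x}"

definition scaleU_inv :: "real measure \<Rightarrow> real \<Rightarrow> real" where
  "scaleU_inv \<Lambda> = the_inv_into {0..1} (scaleU \<Lambda>)"

text \<open>A function \<open>f\<close> in the domain is continuous on \<open>[0,1]\<close>, so \<open>f \<circ> scaleU_inv \<Lambda>\<close> is itself the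
  continuous (hence the absolutely continuous) representative of its Sobolev class.\<close>

definition energy_domain :: "real \<Rightarrow> real measure \<Rightarrow> (real \<Rightarrow> real) set" where
  "energy_domain p \<Lambda> = {f. continuous_on {0..1} f \<and> sobolev01 p (f \<circ> scaleU_inv \<Lambda>)}"

definition energy :: "real \<Rightarrow> real measure \<Rightarrow> (real \<Rightarrow> real) \<Rightarrow> real" where
  "energy p \<Lambda> f =
     (LINT x:{0<..<1}|lborel. \<bar>weak_deriv01 (f \<circ> scaleU_inv \<Lambda>) x\<bar> powr p)"

text \<open>Since \<open>scaleU \<Lambda>\<close> maps \<open>\<Lambda>\<close> to Lebesgue measure, the following is defined up to
  \<open>\<Lambda>\<close>-null sets; in particular the endpoints 0 and 1 are irrelevant.\<close>

definition energy_deriv :: "real measure \<Rightarrow> (real \<Rightarrow> real) \<Rightarrow> real \<Rightarrow> real" where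
  "energy_deriv \<Lambda> f = weak_deriv01 (f \<circ> scaleU_inv \<Lambda>) \<circ> scaleU \<Lambda>"

section \<open>Poincare inequality and capacity upper estimate\<close>

definition poincare :: "real \<Rightarrow> (real \<Rightarrow> real) \<Rightarrow> real measure \<Rightarrow> real measure \<Rightarrow> bool" where
  "poincare p \<Psi> \<Lambda> \<mu> \<longleftrightarrow>
     (\<exists>C>0. \<forall>f\<in>energy_domain p \<Lambda>. \<forall>x\<in>{0..1}. \<forall>r>0.
        (INF c. LINT y:ball01 x r|\<mu>. \<bar>f y - c\<bar> powr p)
          \<le> C * \<Psi> r * (LINT y:ball01 x r|\<Lambda>. \<bar>energy_deriv \<Lambda> f y\<bar> powr p))"

definition capacity_upper :: "real \<Rightarrow> (real \<Rightarrow> real) \<Rightarrow> real measure \<Rightarrow> real measure \<Rightarrow> bool" where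
  "capacity_upper p \<Psi> \<Lambda> \<mu> \<longleftrightarrow>
     (\<exists>C>0. \<forall>x\<in>{0..1}. \<forall>r>0. \<exists>\<phi>\<in>energy_domain p \<Lambda>.
        (\<forall>y\<in>ball01 x r. \<phi> y = 1) \<and>
        (\<forall>y\<in>{0..1} - ball01 x (2 * r). \<phi> y = 0) \<and>
        energy p \<Lambda> \<phi> \<le> C * (measure \<mu> (ball01 x r) / \<Psi> r))"

end

theory Submission
  imports Defs
begin

text \<open>
  Both inequalities reduce to one comparison of measures. An increment of a function \<open>f\<close> over an
  interval \<open>I\<close> satisfies \<open>\<bar>f y - f z\<bar>\<^sup>p \<le> \<nu>1(I)\<^sup>p\<^sup>-\<^sup>1 \<integral>\<^sub>I \<bar>Df\<bar>\<^sup>p d\<nu>1\<close> by Hoelder's inequality, and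
  the cheapest function that falls from 1 to 0 across \<open>I\<close> has energy \<open>\<nu>1(I)\<^sup>1\<^sup>-\<^sup>p\<close>. Hence the
  Poincare inequality holds as soon as \<open>\<nu>2(B(x,r)) \<nu>1(B(x,r))\<^sup>p\<^sup>-\<^sup>1 \<le> C \<Psi>(r)\<close>, and the capacity
  estimate as soon as \<open>\<Psi>(r) \<le> C \<nu>2(B(x,r)) \<nu>1(I)\<^sup>p\<^sup>-\<^sup>1\<close> for the intervals \<open>I\<close> of length \<open>r\<close> on
  either side of the ball (\<open>poincare_ball\<close>, \<open>cutoff\<close>).

  It remains to find two measures whose product \<open>\<nu>2 \<nu>1\<^sup>p\<^sup>-\<^sup>1\<close> depends on the size of an interval
  only, although \<open>\<Psi>(r)\<close> may be far smaller than \<open>r\<^sup>p\<close>: the measures must then concentrate on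
  different parts of every interval. They are built as triadic cascades. A cell of generation \<open>n\<close>
  passes the fractions \<open>u\<^sub>n\<close>, \<open>1 - 2u\<^sub>n\<close>, \<open>u\<^sub>n\<close> of its \<open>\<nu>1\<close>-mass and the fractions \<open>v\<^sub>n\<close>,
  \<open>1 - 2v\<^sub>n\<close>, \<open>v\<^sub>n\<close> of its \<open>\<nu>2\<close>-mass to its three thirds, where
  \<open>u\<^sub>n\<^sup>p\<^sup>-\<^sup>1 v\<^sub>n = (1 - 2u\<^sub>n)\<^sup>p\<^sup>-\<^sup>1 (1 - 2v\<^sub>n) = \<kappa>\<^sub>n\<close>. All cells of generation \<open>n\<close> then share the
  same product \<open>\<kappa>\<^sub>0 \<dots> \<kappa>\<^sub>n\<^sub>-\<^sub>1\<close>. Since the outer thirds carry equal fractions, adjacent cells of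
  equal generation have comparable masses, which gives doubling and lets balls be compared with
  cells.

  Such fractions exist exactly when \<open>\<kappa>\<^sub>n \<le> 3\<^sup>-\<^sup>p\<close> (\<open>weights_exist\<close>). The ratios
  \<open>\<Psi>(3\<^sup>-\<^sup>n\<^sup>-\<^sup>1) / \<Psi>(3\<^sup>-\<^sup>n)\<close> satisfy this only up to the constant in the scale bounds, but the
  comparable sequence \<open>H n = 3\<^sup>-\<^sup>n\<^sup>p sup {3\<^sup>k\<^sup>p \<Psi>(3\<^sup>-\<^sup>k) | k \<ge> n}\<close> satisfies it exactly; this is
  where the lower exponent being at least \<open>p\<close> enters (\<open>regularised_scale\<close>).

  The analytic input is that a continuous function with a weak derivative is recovered by
  integrating it (\<open>weak_deriv_increment\<close>). It is obtained by testing against smooth approximations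
  of indicator functions of intervals.
\<close>

section \<open>Smooth functions on the line\<close>

text \<open>
  The functions \<open>q(1/x) exp(-1/x)\<close>, extended by 0 to the left half-line. With polynomial factors
  allowed the family is closed under differentiation.
\<close>

definition flat :: "real poly \<Rightarrow> real \<Rightarrow> real" where
  "flat q x = (if 0 < x then poly q (1 / x) * exp (- (1 / x)) else 0)"

lemma flat_tendsto_0: "((\<lambda>x. poly q (1 / x) * exp (- (1 / x))) \<longlongrightarrow> 0) (at_right (0 :: real))"
proof -
  have "((\<lambda>y. poly q y * exp (- y)) \<longlongrightarrow> 0) at_top" for q :: "real poly"
  proof -
    have "((\<lambda>y. \<Sum>i\<le>degree q. coeff q i * (y ^ i / exp y)) \<longlongrightarrow> (\<Sum>i\<le>degree q. coeff q i * 0)) at_top"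
      by (intro tendsto_intros tendsto_power_div_exp_0)
    then show ?thesis
      by (simp add: poly_altdef sum_divide_distrib exp_minus divide_inverse sum_distrib_right mult.assoc)
  qed
  from filterlim_compose[OF this[of q] filterlim_inverse_at_top_right]
  show ?thesis by (simp only: inverse_eq_divide)
qed

text \<open>
  At 0 the difference quotient of such a function is again a function of this form, so it tends to 0
  from the right.
\<close>

lemma flat_derivative: "(flat q has_real_derivative flat (pCons 0 (pCons 0 (q - pderiv q))) x) (at x)"
proof (cases x "0 :: real" rule: linorder_cases)
  case less
  have "\<forall>\<^sub>F y in nhds x. flat q y = 0"
    using less eventually_nhds_in_open[of "{..<0}" x] by (auto simp: flat_def elim!: eventually_mono)
  then show ?thesis using less
    by (subst DERIV_cong_ev[OF refl _ refl]) (auto simp: flat_def)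
next
  case greater
  have "\<forall>\<^sub>F y in nhds x. flat q y = poly q (1 / y) * exp (- (1 / y))"
    using greater eventually_nhds_in_open[of "{0<..}" x] by (auto simp: flat_def elim!: eventually_mono)
  moreover have "((\<lambda>y. poly q (1 / y) * exp (- (1 / y))) has_real_derivative
      flat (pCons 0 (pCons 0 (q - pderiv q))) x) (at x)"
    using greater
    by (auto simp: flat_def field_simps power2_eq_square intro!: derivative_eq_intros DERIV_chain2[OF poly_DERIV])
  ultimately show ?thesis by (subst DERIV_cong_ev[OF refl _ refl]) auto
next
  case equal
  have *: "((\<lambda>y. (flat q y - flat q 0) / (y - 0)) \<longlongrightarrow> 0) (at 0)"
  proof (rule filterlim_split_at)
    show "((\<lambda>y. (flat q y - flat q 0) / (y - 0)) \<longlongrightarrow> 0) (at_left 0)"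
      by (rule tendsto_eventually) (auto simp: flat_def eventually_at_left_field intro!: exI[of _ "-1"])
    have "\<forall>\<^sub>F y in at_right 0. poly (pCons 0 q) (1 / y) * exp (- (1 / y)) = (flat q y - flat q 0) / (y - 0)"
      by (auto simp: flat_def eventually_at_right_field intro!: exI[of _ 1])
    then show "((\<lambda>y. (flat q y - flat q 0) / (y - 0)) \<longlongrightarrow> 0) (at_right 0)"
      using flat_tendsto_0[of "pCons 0 q"] by (rule Lim_transform_eventually[rotated])
  qed
  then show ?thesis using equal by (simp add: has_field_derivative_iff flat_def)
qed

text \<open>
  A class of functions that is closed under differentiation consists of infinitely differentiable
  functions. Generating it inductively reduces this closure to the usual rules of differentiation.
\<close>

inductive_set smooth_functions :: "(real \<Rightarrow> real) set" where
  flat: "flat q \<in> smooth_functions"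
| const: "(\<lambda>_. c) \<in> smooth_functions"
| affine: "f \<in> smooth_functions \<Longrightarrow> (\<lambda>x. f (c * x + d)) \<in> smooth_functions"
| add: "f \<in> smooth_functions \<Longrightarrow> g \<in> smooth_functions \<Longrightarrow> (\<lambda>x. f x + g x) \<in> smooth_functions"
| mult: "f \<in> smooth_functions \<Longrightarrow> g \<in> smooth_functions \<Longrightarrow> (\<lambda>x. f x * g x) \<in> smooth_functions"
| inverse: "f \<in> smooth_functions \<Longrightarrow> (\<And>x. f x \<noteq> 0) \<Longrightarrow> (\<lambda>x. inverse (f x)) \<in> smooth_functions"

lemma smooth_functions_derivative:
  "f \<in> smooth_functions \<Longrightarrow>
     \<exists>f'\<in>smooth_functions. \<forall>x. (f has_real_derivative f' x) (at x)"
proof (induction rule: smooth_functions.induct)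
  case (flat q)
  then show ?case using flat_derivative smooth_functions.flat by blast
next
  case (const c)
  then show ?case using smooth_functions.const[of 0] by (auto intro!: bexI[of _ "\<lambda>_. 0"])
next
  case (affine f c d)
  then obtain f' where f': "f' \<in> smooth_functions" "\<And>x. (f has_real_derivative f' x) (at x)" by blast
  have "((\<lambda>x. f (c * x + d)) has_real_derivative f' (c * x + d) * c) (at x)" for x
    by (rule DERIV_chain2[OF f'(2)]) (auto intro!: derivative_eq_intros)
  then have "((\<lambda>x. f (c * x + d)) has_real_derivative c * f' (c * x + d)) (at x)" for x
    by (subst mult.commute)
  moreover have "(\<lambda>x. c * f' (c * x + d)) \<in> smooth_functions"
    using f' by (intro smooth_functions.intros)
  ultimately show ?case by (intro bexI[of _ "\<lambda>x. c * f' (c * x + d)"]) auto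
next
  case (add f g)
  then obtain f' g' where "f' \<in> smooth_functions" "\<And>x. (f has_real_derivative f' x) (at x)"
    "g' \<in> smooth_functions" "\<And>x. (g has_real_derivative g' x) (at x)" by blast
  then show ?case
    by (intro bexI[of _ "\<lambda>x. f' x + g' x"]) (auto intro!: smooth_functions.intros derivative_eq_intros)
next
  case (mult f g)
  then obtain f' g' where "f' \<in> smooth_functions" "\<And>x. (f has_real_derivative f' x) (at x)"
    "g' \<in> smooth_functions" "\<And>x. (g has_real_derivative g' x) (at x)" by blast
  then show ?case using mult
    by (intro bexI[of _ "\<lambda>x. f' x * g x + g' x * f x"])
      (auto intro!: smooth_functions.add smooth_functions.mult intro: DERIV_mult)
next
  case (inverse f)
  then obtain f' where f': "f' \<in> smooth_functions" "\<And>x. (f has_real_derivative f' x) (at x)" by blast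
  have "(\<lambda>x. (-1) * (inverse (f x) * f' x * inverse (f x))) \<in> smooth_functions"
    using f' inverse by (intro smooth_functions.intros)
  moreover have "((\<lambda>x. inverse (f x)) has_real_derivative (-1) * (inverse (f x) * f' x * inverse (f x))) (at x)" for x
    using DERIV_inverse'[OF f'(2)[of x] inverse.hyps(2)[of x]] by simp
  ultimately show ?case
    by (intro bexI[of _ "\<lambda>x. (-1) * (inverse (f x) * f' x * inverse (f x))"]) auto
qed

lemma smooth_functions_deriv:
  assumes "f \<in> smooth_functions"
  shows "(deriv ^^ k) f \<in> smooth_functions"
proof (induction k)
  case (Suc k)
  then obtain f' where "f' \<in> smooth_functions" "\<And>x. ((deriv ^^ k) f has_real_derivative f' x) (at x)"
    using smooth_functions_derivative by blast
  then show ?case using DERIV_imp_deriv by (metis comp_apply ext funpow.simps(2))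
qed (simp add: assms)

lemma test_function_smooth:
  assumes "f \<in> smooth_functions" "0 < a" "b < 1" "\<And>x. f x \<noteq> 0 \<Longrightarrow> x \<in> {a..b}"
  shows "test_function01 f"
  unfolding test_function01_def
proof (intro conjI allI)
  show "(deriv ^^ k) f field_differentiable at x" for k x
    using smooth_functions_derivative[OF smooth_functions_deriv[OF assms(1), of k]]
    by (auto simp: field_differentiable_def)
  have "closure {x. f x \<noteq> 0} \<subseteq> {a..b}" using assms(4) by (intro closure_minimal) auto
  then show "closure {x. f x \<noteq> 0} \<subseteq> {0<..<1}" using assms(2,3) by auto
qed

text \<open>
  With \<open>e\<close> the function \<open>exp(-1/x)\<close> extended by 0, the quotient \<open>e(t) / (e(t) + e(1 - t))\<close> is such a
  step: its denominator never vanishes.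
\<close>

lemma smooth_step_exists:
  obtains P :: "real \<Rightarrow> real" where "P \<in> smooth_functions"
    "\<And>t. t \<le> 0 \<Longrightarrow> P t = 0" "\<And>t. 1 \<le> t \<Longrightarrow> P t = 1" "\<And>t. P t \<in> {0..1}"
proof
  let ?e = "flat [:1:]"
  let ?P = "\<lambda>t. ?e t * inverse (?e t + ?e ((-1) * t + 1))"
  have pos: "0 < ?e t + ?e ((-1) * t + 1)" for t
    by (cases "0 < t"; cases "t < 1") (auto simp: flat_def intro: add_pos_pos)
  show "?P \<in> smooth_functions"
    by (intro smooth_functions.intros) (metis less_irrefl pos)
  show "?P t = 0" if "t \<le> 0" for t using that by (simp add: flat_def)
  show "?P t = 1" if "1 \<le> t" for t using that by (simp add: flat_def)
  have "0 \<le> ?e t" for t by (simp add: flat_def)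
  then show "?P t \<in> {0..1}" for t
    using pos[of t] by (auto simp: field_simps)
qed

section \<open>Weak derivatives on the unit interval\<close>

text \<open>
  Substituting \<open>x = c + e\<^sub>n t\<close> turns the kernel into the fixed weight \<open>\<rho>\<close> against \<open>h(c + e\<^sub>n t)\<close>,
  which converges by continuity of \<open>h\<close> at \<open>c\<close>.
\<close>

lemma approximate_identity:
  fixes h \<rho> :: "real \<Rightarrow> real" and e :: "nat \<Rightarrow> real"
  assumes h: "continuous_on {0<..<1} h" and cd: "0 < c" "d < 1"
    and \<rho>: "continuous_on UNIV \<rho>" "\<And>t. t \<notin> {0..1} \<Longrightarrow> \<rho> t = 0"
    and e: "\<And>n. 0 < e n" "\<And>n. c + e n \<le> d" "e \<longlonglongrightarrow> 0"
  defines "k \<equiv> \<lambda>n x. indicator {0<..<1} x * h x * (\<rho> ((x - c) / e n) / e n)"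
  shows "integrable lborel (k n)"
    and "(\<lambda>n. LINT x|lborel. k n x) \<longlonglongrightarrow> h c * (LINT t:{0..1}|lborel. \<rho> t)"
proof -
  define f where "f n t = indicator {0..1} t *\<^sub>R (h (c + e n * t) * \<rho> t)" for n t
  have range: "c + e n * t \<in> {c..d}" if "t \<in> {0..1}" for n t
  proof -
    have "e n * t \<le> e n * 1" using e(1)[of n] that by (intro mult_left_mono) auto
    moreover have "0 \<le> e n * t" using e(1)[of n] that by auto
    ultimately show ?thesis using e(2)[of n] by auto
  qed
  have hcd: "continuous_on {c..d} h" using h cd by (auto intro: continuous_on_subset)
  have "set_integrable lborel {0..1} (\<lambda>t. h (c + e n * t) * \<rho> t)" for n
    using range
    by (intro borel_integrable_atLeastAtMost' continuous_intros continuous_on_compose2[OF hcd]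
        continuous_on_subset[OF \<rho>(1)]) auto
  then have f: "integrable lborel (f n)" for n by (simp add: set_integrable_def f_def[abs_def])
  have k: "e n * k n (c + e n * t) = f n t" for n t
  proof (cases "t \<in> {0..1}")
    case True
    then have "c + e n * t \<in> {0<..<1}" using range[of t n] cd by simp
    then show ?thesis using True e(1)[of n] by (simp add: k_def f_def)
  next
    case False
    then show ?thesis using \<rho>(2)[of t] e(1)[of n] by (simp add: k_def f_def)
  qed
  have kf: "k n (c + e n * t) = f n t / e n" for n t
    using k[of n t] e(1)[of n] by (simp add: field_simps)
  show "integrable lborel (k n)"
    using lborel_integrable_real_affine_iff[of "e n" "k n" c] e(1)[of n] f[of n]
    by (simp add: kf)
  have eq: "(LINT x|lborel. k n x) = (LINT t|lborel. f n t)" for n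
    using lborel_integral_real_affine[of "e n" "k n" c] e(1)[of n] by (simp add: kf)
  have "compact (h ` {c..d})" by (intro compact_continuous_image hcd) simp
  then obtain M where M: "\<And>x. x \<in> {c..d} \<Longrightarrow> \<bar>h x\<bar> \<le> M"
    using compact_imp_bounded bounded_iff by (metis imageI real_norm_def)
  have "(\<lambda>n. LINT t|lborel. f n t) \<longlonglongrightarrow> (LINT t|lborel. indicator {0..1} t *\<^sub>R (h c * \<rho> t))"
  proof (rule integral_dominated_convergence)
    show "f n \<in> borel_measurable lborel" for n using f by blast
    have "set_integrable lborel {0..1} (\<lambda>t. M * \<bar>\<rho> t\<bar>)"
      by (intro borel_integrable_atLeastAtMost' continuous_intros continuous_on_subset[OF \<rho>(1)]) auto
    then show "integrable lborel (\<lambda>t. indicator {0..1} t *\<^sub>R (M * \<bar>\<rho> t\<bar>))"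
      by (simp add: set_integrable_def)
    show "AE t in lborel. norm (f n t) \<le> indicator {0..1} t *\<^sub>R (M * \<bar>\<rho> t\<bar>)" for n
      using M[OF range] by (auto simp: f_def indicator_def abs_mult intro!: mult_right_mono)
    have "(\<lambda>n. f n t) \<longlonglongrightarrow> indicator {0..1} t *\<^sub>R (h c * \<rho> t)" for t
    proof -
      have "c < 1" using e(1,2)[of 0] cd by linarith
      then have "isCont h c" using h cd by (intro continuous_on_interior[OF h]) auto
      moreover have "(\<lambda>n. c + e n * t) \<longlonglongrightarrow> c + 0 * t" by (intro tendsto_intros e)
      ultimately have "(\<lambda>n. h (c + e n * t)) \<longlonglongrightarrow> h c" using isCont_tendsto_compose by fastforce
      then show ?thesis unfolding f_def by (intro tendsto_intros)
    qed
    then show "AE t in lborel. (\<lambda>n. f n t) \<longlonglongrightarrow> indicator {0..1} t *\<^sub>R (h c * \<rho> t)" by simp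
    have "\<rho> \<in> borel_measurable borel" using \<rho>(1) by (rule borel_measurable_continuous_onI)
    then show "(\<lambda>t. indicator {0..1} t *\<^sub>R (h c * \<rho> t)) \<in> borel_measurable lborel" by measurable
  qed
  then show "(\<lambda>n. LINT x|lborel. k n x) \<longlonglongrightarrow> h c * (LINT t:{0..1}|lborel. \<rho> t)"
    unfolding eq set_lebesgue_integral_def by (simp add: mult.left_commute)
qed

lemma L1_loc01_Icc: "L1_loc01 g \<Longrightarrow> 0 < a \<Longrightarrow> b < 1 \<Longrightarrow> set_integrable lborel {a..b} g"
proof -
  assume a: "L1_loc01 g" "0 < a" "b < 1"
  then have "{a..b} \<subseteq> {0<..<1}" by auto
  then show ?thesis using a(1) compact_Icc[of a b] unfolding L1_loc01_def by blast
qed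

text \<open>
  Test against the smooth trapezoids that rise from 0 to 1 just to the right of \<open>a\<close> and fall back
  just to the right of \<open>b\<close>. They converge to the indicator of \<open>(a,b]\<close>, and their derivatives are two
  approximate identities, of opposite sign, at \<open>a\<close> and at \<open>b\<close>.
\<close>

lemma weak_deriv_increment:
  assumes w: "has_weak_deriv01 h g" and h: "continuous_on {0<..<1} h"
    and ab: "0 < a" "a < b" "b < 1"
  shows "h b - h a = (LINT x:{a<..b}|lborel. g x)"
proof -
  obtain P where P: "P \<in> smooth_functions"
    "\<And>t. t \<le> 0 \<Longrightarrow> P t = 0" "\<And>t. 1 \<le> t \<Longrightarrow> P t = 1" "\<And>t. P t \<in> {0..1}"
    using smooth_step_exists by blast
  obtain \<rho> where \<rho>: "\<rho> \<in> smooth_functions" "\<And>t. (P has_real_derivative \<rho> t) (at t)"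
    using smooth_functions_derivative[OF P(1)] by blast
  have cont: "continuous_on UNIV f" if "f \<in> smooth_functions" for f
    using smooth_functions_derivative[OF that] DERIV_isCont continuous_at_imp_continuous_on by blast
  have \<rho>0: "\<rho> t = 0" if "t \<notin> {0..1}" for t
  proof -
    consider "t < 0" | "1 < t" using \<open>t \<notin> {0..1}\<close> by fastforce
    then show ?thesis
    proof cases
      case 1
      have "(P has_real_derivative 0) (at t)"
        by (rule has_field_derivative_transform_within_open[of "\<lambda>_. 0" _ _ "{..<0}"])
          (use 1 P(2) in auto)
      then show ?thesis using \<rho>(2) DERIV_unique by blast
    next
      case 2
      have "(P has_real_derivative 0) (at t)"
        by (rule has_field_derivative_transform_within_open[of "\<lambda>_. 1" _ _ "{1<..}"])
          (use 2 P(3) in auto)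
      then show ?thesis using \<rho>(2) DERIV_unique by blast
    qed
  qed
  have \<rho>1: "(LINT t:{0..1}|lborel. \<rho> t) = 1"
  proof -
    have "(LBINT t. \<rho> t * indicator {0..1} t) = P 1 - P 0"
      by (rule integral_FTC_Icc_real) (use \<rho>(2) cont[OF \<rho>(1)] in \<open>auto simp: continuous_on_eq_continuous_at\<close>)
    then show ?thesis using P(2)[of 0] P(3)[of 1] by (simp add: set_lebesgue_integral_def mult.commute)
  qed
  \<comment> \<open>The ramps have width \<open>e n\<close> and stay inside \<open>[a,d]\<close>, a fixed compact part of \<open>(0,1)\<close>.\<close>
  define d e where "d = (1 + b) / 2" and "e n = (1 - b) / 2 / real (Suc n)" for n
  have d: "b < d" "d < 1" using ab by (auto simp: d_def)
  have e: "0 < e n" "b + e n \<le> d" "a + e n \<le> d" for n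
  proof -
    show "0 < e n" using ab by (simp add: e_def)
    have "(1 - b) / 2 / real (Suc n) \<le> (1 - b) / 2 / 1" using ab by (intro divide_left_mono) auto
    then show "b + e n \<le> d" by (simp add: e_def d_def field_simps)
    then show "a + e n \<le> d" using ab by simp
  qed
  have e0: "e \<longlonglongrightarrow> 0"
    unfolding e_def[abs_def] by (rule LIMSEQ_Suc[OF lim_const_over_n])
  define \<eta> where "\<eta> n x = P ((x - a) / e n) - P ((x - b) / e n)" for n x
  have supp: "\<eta> n x = 0" if "x \<notin> {a..d}" for n x
  proof -
    have "x < a \<or> d < x" using that by auto
    then show ?thesis
    proof
      assume "x < a"
      then have "(x - a) / e n \<le> 0" "(x - b) / e n \<le> 0"
        using ab e(1)[of n] by (auto simp: divide_le_0_iff)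
      then show ?thesis by (simp add: \<eta>_def P)
    next
      assume "d < x"
      then have "1 \<le> (x - a) / e n" "1 \<le> (x - b) / e n" using e[of n] by (auto simp: le_divide_eq)
      then show ?thesis by (simp add: \<eta>_def P)
    qed
  qed
  have "(\<lambda>x. P (1 / e n * x + (- a / e n)) + (-1) * P (1 / e n * x + (- b / e n))) \<in> smooth_functions" for n
    by (intro smooth_functions.intros P)
  then have "\<eta> n \<in> smooth_functions" for n by (simp add: \<eta>_def[abs_def] diff_divide_distrib)
  then have test: "test_function01 (\<eta> n)" for n
    using test_function_smooth[of "\<eta> n" a d] supp ab d by blast
  have deriv: "deriv (\<eta> n) x = \<rho> ((x - a) / e n) / e n - \<rho> ((x - b) / e n) / e n" for n x
  proof (rule DERIV_imp_deriv)
    have "((\<lambda>x. P ((x - c) / e n)) has_real_derivative \<rho> ((x - c) / e n) / e n) (at x)" for c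
    proof -
      have "((\<lambda>x. (x - c) / e n) has_real_derivative 1 / e n) (at x)"
        using e(1)[of n] by (auto intro!: derivative_eq_intros)
      from DERIV_chain2[OF \<rho>(2) this] show ?thesis by simp
    qed
    then show "(\<eta> n has_real_derivative \<rho> ((x - a) / e n) / e n - \<rho> ((x - b) / e n) / e n) (at x)"
      unfolding \<eta>_def[abs_def] by (intro DERIV_diff)
  qed
  let ?k = "\<lambda>c n x. indicator {0<..<1} x * h x * (\<rho> ((x - c) / e n) / e n)"
  note ka = approximate_identity[OF h ab(1) d(2) cont[OF \<rho>(1)] \<rho>0 e(1,3) e0, unfolded \<rho>1 mult_1_right]
  have b0: "0 < b" using ab by simp
  note kb = approximate_identity[OF h b0 d(2) cont[OF \<rho>(1)] \<rho>0 e(1,2) e0, unfolded \<rho>1 mult_1_right]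
  have "(LINT x:{0<..<1}|lborel. h x * deriv (\<eta> n) x) = (LINT x|lborel. ?k a n x) - (LINT x|lborel. ?k b n x)" for n
  proof -
    have "(LINT x:{0<..<1}|lborel. h x * deriv (\<eta> n) x) = (LINT x|lborel. ?k a n x - ?k b n x)"
      unfolding set_lebesgue_integral_def
      by (intro Bochner_Integration.integral_cong refl) (simp add: deriv algebra_simps)
    also have "\<dots> = (LINT x|lborel. ?k a n x) - (LINT x|lborel. ?k b n x)"
      by (rule Bochner_Integration.integral_diff[OF ka(1) kb(1)])
    finally show ?thesis .
  qed
  with tendsto_diff[OF ka(2) kb(2)]
  have lim1: "(\<lambda>n. LINT x:{0<..<1}|lborel. h x * deriv (\<eta> n) x) \<longlonglongrightarrow> h a - h b" by simp
  have gK: "set_integrable lborel {a..d} g"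
    using w ab d by (intro L1_loc01_Icc) (auto simp: has_weak_deriv01_def)
  have "(\<lambda>n. LINT x|lborel. indicator {a..d} x *\<^sub>R (g x * \<eta> n x)) \<longlonglongrightarrow>
      (LINT x|lborel. indicator {a<..b} x *\<^sub>R g x)"
  proof (rule integral_dominated_convergence)
    have [measurable]: "\<eta> n \<in> borel_measurable borel" for n
      using cont[OF \<open>\<eta> n \<in> smooth_functions\<close>] by (rule borel_measurable_continuous_onI)
    have [measurable]: "(\<lambda>x. indicator {a..d} x *\<^sub>R g x) \<in> borel_measurable lborel"
      using gK by (auto simp: set_integrable_def)
    have "(\<lambda>x. (indicator {a..d} x *\<^sub>R g x) * \<eta> n x) \<in> borel_measurable lborel" for n by measurable
    then show "(\<lambda>x. indicator {a..d} x *\<^sub>R (g x * \<eta> n x)) \<in> borel_measurable lborel" for n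
      by (simp add: mult.assoc)
    have "(\<lambda>x. indicator {a<..b} x * (indicator {a..d} x *\<^sub>R g x)) \<in> borel_measurable lborel"
      by measurable
    moreover have "(\<lambda>x. indicator {a<..b} x * (indicator {a..d} x *\<^sub>R g x)) = (\<lambda>x. indicator {a<..b} x *\<^sub>R g x)"
      using d by (auto simp: indicator_def)
    ultimately show "(\<lambda>x. indicator {a<..b} x *\<^sub>R g x) \<in> borel_measurable lborel" by simp
    show "integrable lborel (\<lambda>x. \<bar>indicator {a..d} x *\<^sub>R g x\<bar>)"
      using gK by (intro integrable_abs) (simp add: set_integrable_def)
    have "\<bar>\<eta> n x\<bar> \<le> 1" for n x
      using P(4)[of "(x - a) / e n"] P(4)[of "(x - b) / e n"] by (auto simp: \<eta>_def abs_le_iff)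
    then show "AE x in lborel. norm (indicator {a..d} x *\<^sub>R (g x * \<eta> n x)) \<le> \<bar>indicator {a..d} x *\<^sub>R g x\<bar>" for n
      by (auto simp: indicator_def abs_mult mult_left_le)
    have "(\<lambda>n. indicator {a..d} x *\<^sub>R (g x * \<eta> n x)) \<longlonglongrightarrow> indicator {a<..b} x *\<^sub>R g x" for x
    proof (rule tendsto_eventually)
      have ev: "\<forall>\<^sub>F n in sequentially. P ((x - c) / e n) = (if c < x then 1 else 0)" for c
      proof (cases "c < x")
        case True
        then have "\<forall>\<^sub>F n in sequentially. e n < x - c" using e0 by (intro order_tendstoD) auto
        then show ?thesis
        proof eventually_elim
          case (elim n)
          then have "1 \<le> (x - c) / e n" using e(1)[of n] by simp
          then show ?case using P(3) True by simp
        qed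
      next
        case False
        then have "(x - c) / e n \<le> 0" for n using e(1)[of n] by (simp add: divide_le_0_iff)
        then show ?thesis using P(2) False by simp
      qed
      show "\<forall>\<^sub>F n in sequentially. indicator {a..d} x *\<^sub>R (g x * \<eta> n x) = indicator {a<..b} x *\<^sub>R g x"
        using ev[of a] ev[of b]
      proof eventually_elim
        case (elim n)
        then show ?case using ab d by (auto simp: \<eta>_def indicator_def)
      qed
    qed
    then show "AE x in lborel. (\<lambda>n. indicator {a..d} x *\<^sub>R (g x * \<eta> n x)) \<longlonglongrightarrow> indicator {a<..b} x *\<^sub>R g x"
      by simp
  qed
  moreover have "(LINT x:{0<..<1}|lborel. g x * \<eta> n x) = (LINT x|lborel. indicator {a..d} x *\<^sub>R (g x * \<eta> n x))" for n
    unfolding set_lebesgue_integral_def using supp[of _ n] ab d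
    by (intro Bochner_Integration.integral_cong) (auto simp: indicator_def)
  ultimately have "(\<lambda>n. - (LINT x:{0<..<1}|lborel. g x * \<eta> n x)) \<longlonglongrightarrow> - (LINT x:{a<..b}|lborel. g x)"
    unfolding set_lebesgue_integral_def by (intro tendsto_minus) simp
  then have "(\<lambda>n. LINT x:{0<..<1}|lborel. h x * deriv (\<eta> n) x) \<longlonglongrightarrow> - (LINT x:{a<..b}|lborel. g x)"
    using w test by (simp add: has_weak_deriv01_def)
  from LIMSEQ_unique[OF this lim1] show ?thesis by simp
qed

text \<open>
  The positive and the negative part are densities of two finite measures that agree on all
  half-lines, hence coincide.
\<close>

lemma AE_eq_0_if_integral_Ioi_0:
  fixes f :: "real \<Rightarrow> real"
  assumes f: "integrable lborel f" and z: "\<And>x. (LINT t:{x<..}|lborel. f t) = 0"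
  shows "AE x in lborel. f x = 0"
proof -
  have [measurable]: "f \<in> borel_measurable borel" using f by auto
  let ?p = "\<lambda>x. max 0 (f x)" and ?n = "\<lambda>x. max 0 (- f x)"
  have int: "integrable lborel (\<lambda>t. ?p t * indicator {x<..} t)" 
     "integrable lborel (\<lambda>t. ?n t * indicator {x<..} t)" for x
    using f by (auto intro!: integrable_real_mult_indicator)
  have em: "emeasure (density lborel ?p) {x<..} = ennreal (LINT t|lborel. ?p t * indicator {x<..} t)"
     "emeasure (density lborel ?n) {x<..} = ennreal (LINT t|lborel. ?n t * indicator {x<..} t)" for x
    using int[of x]
    by (subst emeasure_density; (subst nn_integral_eq_integral[symmetric])?;
        auto intro!: nn_integral_cong simp: indicator_def)+
  have "density lborel ?p = density lborel ?n"
  proof (rule measure_eqI_lessThan)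
    fix x :: real
    have "(LINT t|lborel. ?p t * indicator {x<..} t) - (LINT t|lborel. ?n t * indicator {x<..} t) =
        (LINT t|lborel. ?p t * indicator {x<..} t - ?n t * indicator {x<..} t)"
      by (rule Bochner_Integration.integral_diff[OF int, symmetric])
    also have "\<dots> = (LINT t:{x<..}|lborel. f t)"
      unfolding set_lebesgue_integral_def
      by (intro Bochner_Integration.integral_cong) (auto simp: indicator_def max_def)
    finally show "emeasure (density lborel ?p) {x<..} = emeasure (density lborel ?n) {x<..}"
      unfolding em by (simp add: z)
    show "emeasure (density lborel ?p) {x<..} < \<infinity>" unfolding em by simp
  qed auto
  then have "AE x in lborel. ennreal (?p x) = ennreal (?n x)"
    by (intro sigma_finite_measure.density_unique[OF sigma_finite_lborel]) auto
  then show ?thesis by eventually_elim (auto simp: max_def split: if_splits)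
qed

text \<open>
  Two weak derivatives have the same integral over every interval \<open>(a,b]\<close>; exhausting \<open>(0,1)\<close> by
  compact intervals makes their difference integrable, and it then vanishes almost everywhere.
\<close>

lemma weak_deriv_unique:
  assumes "has_weak_deriv01 h g" "has_weak_deriv01 h g'" and h: "continuous_on {0<..<1} h"
  shows "AE x in lborel. x \<in> {0<..<1} \<longrightarrow> g x = g' x"
proof -
  define a where "a n = 1 / real (n + 3)" for n :: nat
  have a: "0 < a n" "a n < 1 - a n" "1 - a n < 1" for n by (auto simp: a_def field_simps)
  have L1: "L1_loc01 g" "L1_loc01 g'" using assms(1,2) by (simp_all add: has_weak_deriv01_def)
  have "AE x in lborel. indicator {a n<..1 - a n} x * (g x - g' x) = 0" for n
  proof (rule AE_eq_0_if_integral_Ioi_0)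
    have int: "set_integrable lborel {x<..1 - a n} g" "set_integrable lborel {x<..1 - a n} g'" if "0 < x" for x
    proof -
      have "set_integrable lborel {x..1 - a n} g" "set_integrable lborel {x..1 - a n} g'"
        using L1_loc01_Icc[OF _ that] L1 a(3)[of n] by blast+
      then show "set_integrable lborel {x<..1 - a n} g" "set_integrable lborel {x<..1 - a n} g'"
        by (auto elim!: set_integrable_subset)
    qed
    from set_integral_diff(1)[OF int[OF a(1)]]
    show "integrable lborel (\<lambda>x. indicator {a n<..1 - a n} x * (g x - g' x))"
      by (simp add: set_integrable_def)
    fix x :: real
    define y where "y = max x (a n)"
    have y: "0 < y" using a[of n] by (simp add: y_def)
    have "(LINT t:{x<..}|lborel. indicator {a n<..1 - a n} t * (g t - g' t)) = (LINT t:{y<..1 - a n}|lborel. g t - g' t)"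
      unfolding set_lebesgue_integral_def
      by (intro Bochner_Integration.integral_cong) (auto simp: indicator_def y_def)
    also have "\<dots> = 0"
    proof (cases "y < 1 - a n")
      case True
      have "(LINT t:{y<..1 - a n}|lborel. g t - g' t) = (LINT t:{y<..1 - a n}|lborel. g t) - (LINT t:{y<..1 - a n}|lborel. g' t)"
        by (rule set_integral_diff(2)[OF int[OF y]])
      then show ?thesis
        using weak_deriv_increment[OF assms(1) h y True a(3)] weak_deriv_increment[OF assms(2) h y True a(3)] by simp
    qed (simp add: set_lebesgue_integral_def)
    finally show "(LINT t:{x<..}|lborel. indicator {a n<..1 - a n} t * (g t - g' t)) = 0" .
  qed
  then have "AE x in lborel. \<forall>n. indicator {a n<..1 - a n} x * (g x - g' x) = 0"
    by (subst AE_all_countable) blast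
  then show ?thesis
  proof eventually_elim
    case (elim x)
    show ?case
    proof
      assume x: "x \<in> {0<..<1}"
      have "a \<longlonglongrightarrow> 0" unfolding a_def by (rule LIMSEQ_ignore_initial_segment[OF lim_const_over_n])
      then have "\<forall>\<^sub>F n in sequentially. a n < min x (1 - x)" using x by (intro order_tendstoD) auto
      then obtain n where "a n < min x (1 - x)" by (auto simp: eventually_sequentially)
      then show "g x = g' x" using elim[rule_format, of n] by (auto simp: indicator_def)
    qed
  qed
qed

text \<open>
  Local integrability gives measurability on compact subintervals only; \<open>(0,1)\<close> is their union.
\<close>

lemma L1_loc01_measurable:
  assumes "L1_loc01 g"
  shows "(\<lambda>x. indicator {0<..<1} x * g x) \<in> borel_measurable borel"
proof (rule borel_measurable_LIMSEQ_real)
  define e where "e n = 1 / real (Suc n)" for n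
  have e: "0 < e n" for n by (simp add: e_def)
  have e0: "e \<longlonglongrightarrow> 0" unfolding e_def[abs_def] by (rule LIMSEQ_Suc[OF lim_const_over_n])
  show "(\<lambda>x. indicator {e n..1 - e n} x * g x) \<in> borel_measurable borel" for n
    using L1_loc01_Icc[OF assms e, of "1 - e n" n] e[of n] by (auto simp: set_integrable_def)
  show "(\<lambda>n. indicator {e n..1 - e n} x * g x) \<longlonglongrightarrow> indicator {0<..<1} x * g x" for x
  proof (cases "x \<in> {0<..<1}")
    case True
    then have "\<forall>\<^sub>F n in sequentially. e n < min x (1 - x)" using e0 by (intro order_tendstoD) auto
    then have "\<forall>\<^sub>F n in sequentially. indicator {e n..1 - e n} x * g x = indicator {0<..<1} x * g x"
      by eventually_elim (use True in \<open>auto simp: indicator_def\<close>)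
    then show ?thesis by (rule tendsto_eventually)
  next
    case False
    then have "indicator {e n..1 - e n} x * g x = indicator {0<..<1} x * g x" for n
      using e[of n] by (auto simp: indicator_def)
    then show ?thesis by (simp only: tendsto_const)
  qed
qed

text \<open>
  The selected weak derivative need not be the \<open>p\<close>-integrable one that the Sobolev condition
  provides, but uniqueness transfers integrability from one to the other.
\<close>

lemma weak_deriv01_works:
  assumes "sobolev01 p h" and h: "continuous_on {0<..<1} h"
  shows "has_weak_deriv01 h (weak_deriv01 h)"
    and "set_integrable lborel {0<..<1} (\<lambda>x. \<bar>weak_deriv01 h x\<bar> powr p)"
proof -
  obtain g where g: "has_weak_deriv01 h g" "Lp01 p g" using assms(1) by (auto simp: sobolev01_def)
  show w: "has_weak_deriv01 h (weak_deriv01 h)"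
    unfolding weak_deriv01_def by (rule someI[where P = "has_weak_deriv01 h", OF g(1)])
  let ?w = "weak_deriv01 h"
  have [measurable]: "(\<lambda>x. indicator {0<..<1} x * ?w x) \<in> borel_measurable borel"
    using w by (intro L1_loc01_measurable) (simp add: has_weak_deriv01_def)
  have eq: "(\<lambda>x. indicator {0<..<1} x *\<^sub>R \<bar>?w x\<bar> powr p) =
      (\<lambda>x. indicator {0<..<1} x * \<bar>indicator {0<..<1} x * ?w x\<bar> powr p)"
    by (auto simp: indicator_def)
  show "set_integrable lborel {0<..<1} (\<lambda>x. \<bar>?w x\<bar> powr p)"
    unfolding set_integrable_def
  proof (rule integrable_cong_AE_imp)
    show "integrable lborel (\<lambda>x. indicator {0<..<1} x *\<^sub>R \<bar>g x\<bar> powr p)"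
      using g(2) by (simp add: Lp01_def set_integrable_def)
    show "(\<lambda>x. indicator {0<..<1} x *\<^sub>R \<bar>?w x\<bar> powr p) \<in> borel_measurable lborel"
      unfolding eq by measurable
    show "AE x in lborel. indicator {0<..<1} x *\<^sub>R \<bar>g x\<bar> powr p = indicator {0<..<1} x *\<^sub>R \<bar>?w x\<bar> powr p"
      using weak_deriv_unique[OF g(1) w h] by eventually_elim (auto simp: indicator_def)
  qed
qed

text \<open>
  The product of \<open>h\<close> with a test function vanishes at both endpoints, and the fundamental theorem of
  calculus tolerates finitely many points without derivative.
\<close>

lemma has_weak_deriv01_piecewise:
  fixes h g :: "real \<Rightarrow> real"
  assumes S: "finite S" and h: "continuous_on {0..1} h"
    and hg: "\<And>x. x \<in> {0<..<1} - S \<Longrightarrow> (h has_real_derivative g x) (at x)"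
    and gm [measurable]: "g \<in> borel_measurable borel" and gM: "\<And>x. \<bar>g x\<bar> \<le> M"
  shows "has_weak_deriv01 h g"
proof -
  have bdd: "set_integrable lborel K k"
    if "compact K" "k \<in> borel_measurable borel" "\<And>x. x \<in> K \<Longrightarrow> \<bar>k x\<bar> \<le> c" for K c and k :: "real \<Rightarrow> real"
    unfolding set_integrable_def
  proof (rule Bochner_Integration.integrable_bound)
    have K: "K \<in> sets borel" using that(1) by (simp add: compact_imp_closed)
    show "integrable lborel (\<lambda>x. c * indicator K x :: real)"
      using emeasure_compact_finite[OF that(1)] K by (intro integrable_mult_right integrable_real_indicator) auto
    show "(\<lambda>x. indicator K x *\<^sub>R k x) \<in> borel_measurable lborel" using that(2) K by measurable
    show "AE x in lborel. norm (indicator K x *\<^sub>R k x) \<le> norm (c * indicator K x :: real)"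
      using that(3) by (intro always_eventually allI) (force simp: indicator_def)
  qed
  have "L1_loc01 h"
    unfolding L1_loc01_def
  proof (intro allI impI)
    fix K :: "real set" assume K: "compact K \<and> K \<subseteq> {0<..<1}"
    then have "K \<subseteq> {0..1}" by auto
    then show "set_integrable lborel K h"
      using K h unfolding set_integrable_def
      by (intro borel_integrable_compact) (auto intro: continuous_on_subset)
  qed
  moreover have "L1_loc01 g" unfolding L1_loc01_def using bdd[OF _ gm gM] by blast
  moreover have "(LINT x:{0<..<1}|lborel. h x * deriv \<eta> x) = - (LINT x:{0<..<1}|lborel. g x * \<eta> x)"
    if t: "test_function01 \<eta>" for \<eta>
  proof -
    have d: "((deriv ^^ k) \<eta>) field_differentiable (at x)" for k x
      using t by (simp add: test_function01_def)
    have \<eta>': "(\<eta> has_real_derivative deriv \<eta> x) (at x)" for x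
      using d[of 0 x] by (simp add: field_differentiable_derivI DERIV_deriv_iff_field_differentiable)
    have ce: "continuous_on A \<eta>" for A
      using d[of 0] by (auto intro!: continuous_at_imp_continuous_on field_differentiable_imp_continuous_at)
    have cd: "continuous_on A (deriv \<eta>)" for A
      using d[of 1] by (auto intro!: continuous_at_imp_continuous_on field_differentiable_imp_continuous_at)
    have "closure {x. \<eta> x \<noteq> 0} \<subseteq> {0<..<1}" using t by (simp add: test_function01_def)
    then have "{x. \<eta> x \<noteq> 0} \<subseteq> {0<..<1}" by (rule subset_trans[OF closure_subset])
    then have z: "\<eta> 0 = 0" "\<eta> 1 = 0" by (auto simp: subset_eq)
    have [measurable]: "\<eta> \<in> borel_measurable borel" by (rule borel_measurable_continuous_onI[OF ce])
    have "compact (\<eta> ` {0..1})" by (intro compact_continuous_image ce) simp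
    then obtain c where c: "\<And>x. x \<in> {0..1} \<Longrightarrow> \<bar>\<eta> x\<bar> \<le> c"
      using compact_imp_bounded bounded_iff by (metis imageI real_norm_def)
    have i1: "set_integrable lborel {0..1} (\<lambda>x. g x * \<eta> x)"
    proof (rule bdd)
      show "\<bar>g x * \<eta> x\<bar> \<le> M * c" if "x \<in> {0..1}" for x
        using gM[of x] c[OF that] by (auto simp: abs_mult intro!: mult_mono)
    qed auto
    have i2: "set_integrable lborel {0..1} (\<lambda>x. h x * deriv \<eta> x)"
      by (intro borel_integrable_atLeastAtMost' continuous_intros h cd)
    have "((\<lambda>x. g x * \<eta> x + h x * deriv \<eta> x) has_integral (h 1 * \<eta> 1 - h 0 * \<eta> 0)) {0..1}"
    proof (rule fundamental_theorem_of_calculus_interior_strong[OF S])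
      fix x :: real assume x: "x \<in> {0<..<1} - S"
      have "((\<lambda>x. h x * \<eta> x) has_real_derivative g x * \<eta> x + deriv \<eta> x * h x) (at x)"
        by (rule DERIV_mult[OF hg[OF x] \<eta>'])
      then show "((\<lambda>x. h x * \<eta> x) has_vector_derivative g x * \<eta> x + h x * deriv \<eta> x) (at x)"
        by (simp add: has_real_derivative_iff_has_vector_derivative mult.commute)
    qed (auto intro!: continuous_intros h ce)
    then have "integral {0..1} (\<lambda>x. g x * \<eta> x + h x * deriv \<eta> x) = 0"
      by (simp add: z integral_unique)
    then have "(LINT x:{0..1}|lborel. g x * \<eta> x) + (LINT x:{0..1}|lborel. h x * deriv \<eta> x) = 0"
      using set_borel_integral_eq_integral(2)[OF set_integral_add(1)[OF i1 i2]] set_integral_add(2)[OF i1 i2]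
      by simp
    moreover have "(LINT x:{0<..<1}|lborel. k x) = (LINT x:{0..1}|lborel. k x)" for k :: "real \<Rightarrow> real"
      using interval_integral_Icc[of 0 1 k] interval_integral_Ioo[of 0 1 k]
      by (simp add: zero_ereal_def one_ereal_def)
    ultimately show ?thesis by simp
  qed
  ultimately show ?thesis by (simp add: has_weak_deriv01_def)
qed

section \<open>The measure with a given distribution function\<close>

text \<open>
  The distribution functions of the non-atomic probability measures on \<open>[0,1]\<close> with full support,
  extended by constants to the real line.
\<close>

locale unit_cdf =
  fixes F :: "real \<Rightarrow> real"
  assumes mono: "\<And>x y. x \<le> y \<Longrightarrow> F x \<le> F y"
    and cont: "\<And>x. isCont F x"
    and left: "\<And>x. x \<le> 0 \<Longrightarrow> F x = 0"
    and right: "\<And>x. 1 \<le> x \<Longrightarrow> F x = 1"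
    and strict: "\<And>s t. 0 \<le> s \<Longrightarrow> s < t \<Longrightarrow> t \<le> 1 \<Longrightarrow> F s < F t"
begin

definition law :: "real measure" where
  "law = restrict_space (interval_measure F) {0..1}"

lemma continuous_on_F: "continuous_on A F"
  by (simp add: cont continuous_at_imp_continuous_on)

lemma range_F: "F x \<in> {0..1}"
  using mono[of "min x 0" x] mono[of x "max x 1"] left[of "min x 0"] right[of "max x 1"] by simp

lemma finite_borel: "finite_borel_measure (interval_measure F)"
  and interval_measure_total: "emeasure (interval_measure F) UNIV = 1"
proof -
  have 1: "(F \<longlongrightarrow> 0) at_bot"
    by (rule tendsto_eventually) (auto simp: eventually_at_bot_linorder intro!: exI[of _ 0] left)
  have 2: "(F \<longlongrightarrow> 1) at_top"
    by (rule tendsto_eventually) (auto simp: eventually_at_top_linorder intro!: exI[of _ 1] right)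
  have 3: "continuous (at_right a) F" for a using cont continuous_at_imp_continuous_at_within by blast
  show "finite_borel_measure (interval_measure F)"
    by (rule finite_borel_measure_interval_measure[OF mono 3 1 2]) auto
  show "emeasure (interval_measure F) UNIV = 1"
    using interval_measure_UNIV[OF mono 3 1 2] by simp
qed

lemma emeasure_Icc: "a \<le> b \<Longrightarrow> emeasure (interval_measure F) {a..b} = ennreal (F b - F a)"
  by (rule emeasure_interval_measure_Icc[OF _ mono continuous_on_F])

lemma sets_law: "sets law = sets (restrict_space borel {0..1})"
  unfolding law_def by (intro sets_restrict_space_cong) simp

lemma space_law: "space law = {0..1}" by (simp add: law_def space_restrict_space)

lemma sets_law_iff: "A \<in> sets law \<longleftrightarrow> A \<in> sets borel \<and> A \<subseteq> {0..1}"
  by (auto simp: sets_law sets_restrict_space_iff)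

lemma emeasure_law: "A \<subseteq> {0..1} \<Longrightarrow> emeasure law A = emeasure (interval_measure F) A"
  unfolding law_def by (rule emeasure_restrict_space) auto

lemma prob_law: "prob_space law"
  by (rule prob_spaceI) (simp add: space_law emeasure_law emeasure_Icc left right)

lemma measure_law: "A \<subseteq> {0..1} \<Longrightarrow> measure law A = measure (interval_measure F) A"
  by (simp add: measure_def emeasure_law)

lemma measure_Icc: "0 \<le> a \<Longrightarrow> a \<le> b \<Longrightarrow> b \<le> 1 \<Longrightarrow> measure law {a..b} = F b - F a"
  using mono[of a b] by (simp add: measure_def emeasure_law emeasure_Icc)

lemma measure_le_F:
  assumes "A \<subseteq> {a..b}" "A \<in> sets law" "a \<le> b"
  shows "measure law A \<le> F b - F a"
proof -
  interpret finite_borel_measure "interval_measure F" by (rule finite_borel)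
  have "measure law A \<le> measure (interval_measure F) {a..b}"
    using assms by (auto simp: sets_law_iff measure_law intro!: finite_measure_mono)
  also have "\<dots> = F b - F a" using mono[OF assms(3)] assms(3) by (simp add: measure_def emeasure_Icc)
  finally show ?thesis .
qed

lemma measure_ge_F:
  assumes "{a..b} \<subseteq> A" "A \<in> sets law" "a \<le> b"
  shows "F b - F a \<le> measure law A"
proof -
  interpret prob_space law by (rule prob_law)
  have ab: "{a..b} \<subseteq> {0..1}" using assms(1,2) unfolding sets_law_iff by blast
  then have "{a..b} \<in> sets law" by (auto simp: sets_law_iff)
  then have "measure law {a..b} \<le> measure law A" using assms by (intro finite_measure_mono)
  moreover have "measure law {a..b} = F b - F a" using assms(3) ab by (intro measure_Icc) (simp_all add: atLeastatMost_subset_iff)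
  ultimately show ?thesis by simp
qed

lemma sets_ball: "ball01 x r \<in> sets law"
proof -
  have "ball01 x r = {0..1} \<inter> ball x r" by (auto simp: ball01_def dist_real_def)
  then show ?thesis by (auto simp: sets_law_iff)
qed

lemma radon_law: "radon01 law"
  unfolding radon01_def
proof (intro conjI ballI allI impI)
  interpret prob_space law by (rule prob_law)
  show "sets law = sets (restrict_space borel {0..1})" by (rule sets_law)
  show "emeasure law K < \<infinity>" for K using emeasure_finite[of K] by (simp add: less_top[symmetric])
  fix A assume "A \<in> sets law"
  then have A: "A \<in> sets borel" "A \<subseteq> {0..1}" by (auto simp: sets_law_iff)
  have "emeasure law A = emeasure (interval_measure F) A" by (simp add: emeasure_law A)
  also have "\<dots> = (SUP K\<in>{K. K \<subseteq> A \<and> compact K}. emeasure (interval_measure F) K)"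
    by (rule inner_regular) (auto simp: A interval_measure_total)
  also have "\<dots> = (SUP K\<in>{K. compact K \<and> K \<subseteq> A}. emeasure law K)"
    using A by (intro SUP_cong) (auto simp: emeasure_law)
  finally show "emeasure law A = (SUP K\<in>{K. compact K \<and> K \<subseteq> A}. emeasure law K)" .
qed

text \<open>
  The mass of \<open>A \<inter> [0,t]\<close> depends continuously on \<open>t\<close>, so some \<open>t\<close> cuts \<open>A\<close> into halves.
\<close>

lemma nonatomic_law: "nonatomic law"
  unfolding nonatomic_def
proof (safe, goal_cases)
  interpret prob_space law by (rule prob_law)
  case (1 A)
  let ?m = "\<lambda>t. measure law (A \<inter> {0..t})"
  have A: "A \<in> sets borel" "A \<subseteq> {0..1}" using 1 by (auto simp: sets_law_iff)
  have sets: "A \<inter> {a..t} \<in> sets law" "A \<inter> {a<..t} \<in> sets law" for a t using A by (auto simp: sets_law_iff)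
  have pos: "0 < measure law A" using 1(2) by (simp add: emeasure_eq_measure)
  have step: "?m t \<le> ?m s + (F t - F s)" "?m s \<le> ?m t" if "s \<le> t" for s t
  proof -
    have "?m t \<le> measure law (A \<inter> {0..s} \<union> A \<inter> {s<..t})"
      using that sets by (intro finite_measure_mono) auto
    also have "\<dots> \<le> ?m s + measure law (A \<inter> {s<..t})" using sets by (intro measure_Un_le)
    also have "measure law (A \<inter> {s<..t}) \<le> F t - F s"
      using sets that by (intro measure_le_F) auto
    finally show "?m t \<le> ?m s + (F t - F s)" by simp
    show "?m s \<le> ?m t" using that sets by (intro finite_measure_mono) auto
  qed
  have "isCont ?m x" for x
    unfolding continuous_at_eps_delta
  proof (intro allI impI)
    fix e :: real assume "0 < e"
    then obtain d where "d > 0" "\<And>y. dist y x < d \<Longrightarrow> dist (F y) (F x) < e"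
      using cont[of x] unfolding continuous_at_eps_delta by blast
    then show "\<exists>d>0. \<forall>y. dist y x < d \<longrightarrow> dist (?m y) (?m x) < e"
      using step[of x] step[of _ x]
      by (intro exI[of _ d]) (smt (verit, best) dist_real_def)
  qed
  then have "continuous_on {0..1} ?m" by (simp add: continuous_at_imp_continuous_on)
  moreover have "?m 1 = measure law A" using A(2) by (simp add: Int_absorb2)
  moreover have "?m 0 \<le> 0"
    using measure_le_F[of "A \<inter> {0..0}" 0 0] sets[of 0 0] by simp
  ultimately obtain t where t: "?m t = measure law A / 2"
    using IVT'[of ?m 0 "measure law A / 2" 1] pos by (metis field_sum_of_halves less_add_same_cancel1 less_eq_real_def half_gt_zero order_trans zero_le_one)
  have "emeasure law (A \<inter> {0..t}) < emeasure law A"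
    unfolding emeasure_eq_measure t using pos by (simp add: ennreal_less_iff)
  moreover have "A \<inter> {0..t} \<in> sets law" "A \<inter> {0..t} \<subseteq> A" using sets by auto
  ultimately have "emeasure law (A \<inter> {0..t}) = 0" using 1(3) by blast
  then show False unfolding emeasure_eq_measure t using pos by simp
qed

lemma full_support_law: "full_support01 law"
  unfolding full_support01_def
proof (intro allI impI, elim conjE)
  fix V :: "real set" assume V: "open V" "V \<inter> {0..1} \<noteq> {}"
  then obtain x where x: "x \<in> V" "x \<in> {0..1}" by blast
  obtain e where e: "e > 0" "\<And>y. dist y x < e \<Longrightarrow> y \<in> V" using V(1) x(1) open_dist by metis
  define s t where "s = (if x = 0 then 0 else max 0 (x - e/2))"
    and "t = (if x = 0 then min 1 (e/2) else x)"
  have st: "0 \<le> s" "s < t" "t \<le> 1" using x e(1) by (auto simp: s_def t_def)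
  have "{s..t} \<subseteq> V"
    using e x by (auto simp: s_def t_def dist_real_def split: if_splits)
  moreover have "V \<inter> {0..1} \<in> sets law" using V(1) by (auto simp: sets_law_iff)
  ultimately have "F t - F s \<le> measure law (V \<inter> {0..1})" using st by (intro measure_ge_F) auto
  then have "0 < measure law (V \<inter> {0..1})" using strict[OF st] by linarith
  then show "0 < emeasure law (V \<inter> {0..1})"
    by (metis measure_def enn2real_0 less_irrefl gr_zeroI)
qed

lemma admissible_law: "admissible01 law"
  by (simp add: admissible01_def radon_law prob_law nonatomic_law full_support_law)

lemma scaleU_law: "x \<in> {0..1} \<Longrightarrow> scaleU law x = F x"
  by (simp add: scaleU_def measure_Icc left)

lemma bij_F: "bij_betw F {0..1} {0..1}"
proof -
  have "F x \<noteq> F y" if "x < y" "x \<in> {0..1}" "y \<in> {0..1}" for x y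
    using strict[of x y] that by simp
  then have "inj_on F {0..1}" by (intro linorder_inj_onI) auto
  moreover have "\<exists>x\<in>{0..1}. F x = z" if "z \<in> {0..1}" for z
    using IVT'[of F 0 z 1] that continuous_on_F by (auto simp: left right)
  then have "F ` {0..1} = {0..1}" using range_F by (auto simp: image_iff) metis
  ultimately show ?thesis by (simp add: bij_betw_def)
qed

lemma bij_scaleU: "bij_betw (scaleU law) {0..1} {0..1}"
  using bij_F bij_betw_cong[of "{0..1}" "scaleU law" F] scaleU_law by blast

lemma scaleU_inv_F: "x \<in> {0..1} \<Longrightarrow> scaleU_inv law (F x) = x"
  unfolding scaleU_inv_def using bij_scaleU
  by (metis bij_betw_def scaleU_law the_inv_into_f_f)

lemma F_scaleU_inv: "z \<in> {0..1} \<Longrightarrow> F (scaleU_inv law z) = z"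
  and scaleU_inv_range: "z \<in> {0..1} \<Longrightarrow> scaleU_inv law z \<in> {0..1}"
  using bij_F scaleU_inv_F by (metis (no_types, lifting) bij_betw_def imageE)+

lemma continuous_scaleU_inv: "continuous_on {0..1} (scaleU_inv law)"
proof -
  have "continuous_on (F ` {0..1}) (scaleU_inv law)"
    by (rule continuous_on_inv[OF continuous_on_F]) (auto simp: scaleU_inv_F)
  then show ?thesis using bij_F by (simp add: bij_betw_def)
qed

lemma measurable_F: "F \<in> borel_measurable law"
  unfolding law_def
  using borel_measurable_continuous_onI[OF continuous_on_F]
  by (intro measurable_restrict_space1) (simp add: measurable_cong_sets[OF sets_interval_measure refl])

text \<open>
  The probability integral transform: both sides have the distribution function of the uniform
  distribution.
\<close>

lemma distr_law: "distr law borel F = density lborel (indicator {0..1})"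
proof (rule cdf_unique)
  interpret prob_space law by (rule prob_law)
  show 1: "real_distribution (distr law borel F)"
    by (intro real_distribution_distr measurable_F)
  interpret U: prob_space "density lborel (indicator {0..1::real})"
    by (rule prob_spaceI) (simp add: emeasure_density)
  show 2: "real_distribution (density lborel (indicator {0..1::real}))"
    by unfold_locales auto
  show "cdf (distr law borel F) = cdf (density lborel (indicator {0..1}))"
  proof
    fix z :: real
    have "measure law (F -` {..z} \<inter> {0..1}) = measure lborel ({0..1} \<inter> {..z})"
    proof (cases "z \<in> {0..1}")
      case True
      define t where "t = scaleU_inv law z"
      have t: "t \<in> {0..1}" "F t = z"
        using True F_scaleU_inv scaleU_inv_range by (auto simp: t_def)
      have "F -` {..z} \<inter> {0..1} = {0..t}"
        using t mono strict[of t] by (auto simp: not_less[symmetric] simp flip: t(2))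
      then have "measure law (F -` {..z} \<inter> {0..1}) = z" using t by (simp add: measure_Icc left)
      moreover have "{0..1} \<inter> {..z} = {0..z}" using True by auto
      ultimately show ?thesis using True by simp
    next
      case False
      then consider "z < 0" | "z > 1" by fastforce
      then show ?thesis
      proof cases
        case 1
        then have "F -` {..z} \<inter> {0..1} = {}" "{0..1} \<inter> {..z} = {}"
          using range_F by (auto simp: not_le) (meson atLeastAtMost_iff leD le_less_trans)
        then show ?thesis by simp
      next
        case 2
        then have "F -` {..z} \<inter> {0..1} = space law" "{0..1} \<inter> {..z} = {0..1}"
          using range_F by (auto simp: space_law) (meson atLeastAtMost_iff less_imp_le order_trans)
        then show ?thesis using prob_space by simp
      qed
    qed
    moreover have "measure (density lborel (indicator {0..1})) {..z} = measure lborel ({0..1} \<inter> {..z})"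
      by (simp add: measure_def emeasure_density flip: indicator_inter_arith)
    ultimately show "cdf (distr law borel F) z = cdf (density lborel (indicator {0..1})) z"
      unfolding cdf_def by (simp add: measure_distr measurable_F space_law)
  qed
qed

lemma image_F: "A \<subseteq> {0..1} \<Longrightarrow> F ` A = {z \<in> {0..1}. scaleU_inv law z \<in> A}"
  using scaleU_inv_F F_scaleU_inv range_F by (auto simp: image_iff subset_eq) metis

lemma borel_image_F:
  assumes "A \<in> sets law"
  shows "F ` A \<in> sets borel"
proof -
  have A: "A \<in> sets borel" "A \<subseteq> {0..1}" using assms by (auto simp: sets_law_iff)
  have "scaleU_inv law \<in> borel_measurable (restrict_space borel {0..1})"
    by (rule borel_measurable_continuous_on_restrict[OF continuous_scaleU_inv])
  from measurable_sets[OF this A(1)] show ?thesis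
    unfolding image_F[OF A(2)]
    by (simp add: space_restrict_space sets_restrict_space_iff vimage_def Int_def conj_commute)
qed

lemma integral_law:
  fixes g :: "real \<Rightarrow> real"
  assumes A: "A \<in> sets law" and [measurable]: "g \<in> borel_measurable borel"
  shows "(LINT y:A|law. g (F y)) = (LINT z:F ` A|lborel. g z)"
proof -
  have A': "A \<in> sets borel" "A \<subseteq> {0..1}" using A by (auto simp: sets_law_iff)
  note FA = image_F[OF A'(2)]
  have [measurable]: "F ` A \<in> sets borel" by (rule borel_image_F[OF A])
  have "(LINT y:A|law. g (F y)) = (LINT y|law. indicator (F ` A) (F y) * g (F y))"
    unfolding set_lebesgue_integral_def
  proof (intro Bochner_Integration.integral_cong refl)
    fix y assume "y \<in> space law"
    then have "F y \<in> F ` A \<longleftrightarrow> y \<in> A"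
      using A'(2) scaleU_inv_F by (auto simp: space_law image_iff subset_eq) metis
    then show "indicat_real A y *\<^sub>R g (F y) = indicat_real (F ` A) (F y) * g (F y)"
      by (simp add: indicator_def)
  qed
  also have "\<dots> = (LINT z|distr law borel F. indicator (F ` A) z * g z)"
    by (subst integral_distr[OF measurable_F]) auto
  also have "\<dots> = (LINT z|lborel. indicator {0..1} z *\<^sub>R (indicator (F ` A) z * g z))"
    unfolding distr_law ennreal_indicator[symmetric] by (subst integral_density) auto
  also have "\<dots> = (LINT z:F ` A|lborel. g z)"
    unfolding set_lebesgue_integral_def
    by (intro Bochner_Integration.integral_cong refl) (auto simp: indicator_def FA)
  finally show ?thesis .
qed

end

section \<open>The Poincare inequality on a ball\<close>

text \<open>
  The convex function \<open>t\<^sup>p\<close> lies above its tangent at 1; this is Young's inequality for \<open>t\<^sup>p\<close> and 1.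
\<close>

lemma powr_above_tangent:
  fixes t p :: real
  assumes "0 \<le> t" "1 < p"
  shows "1 + p * (t - 1) \<le> t powr p"
proof (cases "t = 0")
  case False
  then have "0 < t" using assms by simp
  have "(t powr p) powr (1 / p) * 1 powr (1 - 1 / p) \<le> 1 / p * t powr p + (1 - 1 / p) * 1"
    using assms \<open>0 < t\<close> by (intro Youngs_inequality_0) auto
  then have "t \<le> 1 / p * t powr p + (1 - 1 / p)" using assms \<open>0 < t\<close> by (simp add: powr_powr)
  then have "p * t \<le> p * (1 / p * t powr p + (1 - 1 / p))" using assms by (intro mult_left_mono) auto
  then show ?thesis using assms by (simp add: algebra_simps)
qed (use assms in simp)

text \<open>
  Hoelder's inequality against the constant 1. Scaling by the mean \<open>m\<close> of \<open>\<bar>g\<bar>\<close> and integrating the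
  tangent bound gives it without a dual exponent.
\<close>

lemma integral_powr_le:
  fixes g :: "real \<Rightarrow> real"
  assumes ab: "a < b" and p: "1 < p"
    and g: "set_integrable lborel {a<..b} g" "set_integrable lborel {a<..b} (\<lambda>x. \<bar>g x\<bar> powr p)"
  shows "\<bar>LINT x:{a<..b}|lborel. g x\<bar> powr p \<le>
    (b - a) powr (p - 1) * (LINT x:{a<..b}|lborel. \<bar>g x\<bar> powr p)"
proof -
  let ?I = "LINT x:{a<..b}|lborel. \<bar>g x\<bar>" and ?J = "LINT x:{a<..b}|lborel. \<bar>g x\<bar> powr p"
  have gabs: "set_integrable lborel {a<..b} (\<lambda>x. \<bar>g x\<bar>)" by (rule set_integrable_abs[OF g(1)])
  have I: "\<bar>LINT x:{a<..b}|lborel. g x\<bar> \<le> ?I"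
    using set_integral_norm_bound[OF g(1)] by simp
  have J: "0 \<le> ?J" unfolding set_lebesgue_integral_def by (intro integral_nonneg_AE) auto
  show ?thesis
  proof (cases "?I = 0")
    case True
    then show ?thesis using I J by simp
  next
    case False
    define m where "m = ?I / (b - a)"
    have I0: "0 < ?I" using I False by linarith
    then have m: "0 < m" using ab by (simp add: m_def)
    have c: "set_integrable lborel {a<..b} (\<lambda>x. c :: real)" for c
      using ab by (simp add: set_integrable_def)
    have "(LINT x:{a<..b}|lborel. (1 - p) * m powr p + p * m powr p / m * \<bar>g x\<bar>) \<le> ?J"
    proof (rule set_integral_mono)
      show "set_integrable lborel {a<..b} (\<lambda>x. (1 - p) * m powr p + p * m powr p / m * \<bar>g x\<bar>)"
        using gabs by (intro set_integral_add(1) c set_integrable_mult_right) auto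
      fix x
      have "1 + p * (\<bar>g x\<bar> / m - 1) \<le> (\<bar>g x\<bar> / m) powr p"
        using m p by (intro powr_above_tangent) auto
      then have "m powr p * (1 + p * (\<bar>g x\<bar> / m - 1)) \<le> m powr p * (\<bar>g x\<bar> / m) powr p"
        by (intro mult_left_mono) auto
      also have "\<dots> = \<bar>g x\<bar> powr p" using m by (simp add: powr_divide)
      finally show "(1 - p) * m powr p + p * m powr p / m * \<bar>g x\<bar> \<le> \<bar>g x\<bar> powr p"
        by (simp add: algebra_simps)
    qed (rule g(2))
    also have "(LINT x:{a<..b}|lborel. (1 - p) * m powr p + p * m powr p / m * \<bar>g x\<bar>) =
        (b - a) * ((1 - p) * m powr p) + p * m powr p / m * ?I"
    proof -
      have "(LINT x:{a<..b}|lborel. (1 - p) * m powr p + p * m powr p / m * \<bar>g x\<bar>) =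
          (LINT x:{a<..b}|lborel. (1 - p) * m powr p) + (LINT x:{a<..b}|lborel. p * m powr p / m * \<bar>g x\<bar>)"
        using gabs by (intro set_integral_add(2) c set_integrable_mult_right) auto
      moreover have "(LINT x:{a<..b}|lborel. k) = (b - a) * k" for k :: real
        using ab by (simp add: set_lebesgue_integral_def)
      ultimately show ?thesis by (simp only: set_integral_mult_right mult.left_commute)
    qed
    also have "\<dots> = (b - a) * m powr p"
      using m ab by (simp add: m_def field_simps)
    finally have "(b - a) powr (p - 1) * ((b - a) * m powr p) \<le> (b - a) powr (p - 1) * ?J"
      by (intro mult_left_mono) auto
    also have "(b - a) powr (p - 1) * ((b - a) * m powr p) = ((b - a) * m) powr p"
      using ab m by (simp add: powr_mult powr_diff)
    also have "(b - a) * m = ?I" using ab by (simp add: m_def)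
    finally have "?I powr p \<le> (b - a) powr (p - 1) * ?J" .
    moreover have "\<bar>LINT x:{a<..b}|lborel. g x\<bar> powr p \<le> ?I powr p"
      using I p by (intro powr_mono2) auto
    ultimately show ?thesis by linarith
  qed
qed

context unit_cdf begin

lemma AE_interior: "AE y in law. y \<in> {0<..<1}"
proof -
  have "emeasure law {a} = 0" if "a \<in> {0..1}" for a
    using that emeasure_Icc[of a a] by (simp add: emeasure_law)
  then have "{0} \<in> null_sets law" "{1} \<in> null_sets law" by (auto simp: null_sets_def sets_law_iff)
  then have "AE y in law. y \<noteq> 0 \<and> y \<noteq> 1" by (auto dest!: AE_not_in)
  then show ?thesis using AE_space by eventually_elim (auto simp: space_law)
qed

lemma strict_iff: "x \<in> {0..1} \<Longrightarrow> y \<in> {0..1} \<Longrightarrow> F x < F y \<longleftrightarrow> x < y"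
proof
  assume "F x < F y"
  then show "x < y" using mono[of y x] by linarith
next
  assume "x \<in> {0..1}" "y \<in> {0..1}" "x < y"
  then show "F x < F y" by (intro strict) auto
qed

lemma interior: "x \<in> {0<..<1} \<Longrightarrow> F x \<in> {0<..<1}"
proof -
  assume "x \<in> {0<..<1}"
  then have "F 0 < F x" "F x < F 1" by (auto intro!: strict)
  then show ?thesis using left[of 0] right[of 1] by simp
qed

text \<open>
  In the coordinate \<open>u = F y\<close> the function becomes absolutely continuous, and the part of the ball
  between \<open>y\<close> and \<open>z\<close> becomes an interval whose length is its mass. The points are kept in the open
  interval because weak derivatives control increments only there.
\<close>

lemma oscillation_le:
  assumes f: "f \<in> energy_domain p law" and p: "1 < p" and r: "0 < r"
    and y: "y \<in> ball01 x r" "y \<in> {0<..<1}" and z: "z \<in> ball01 x r" "z \<in> {0<..<1}"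
  shows "\<bar>f y - f z\<bar> powr p \<le>
    measure law (ball01 x r) powr (p - 1) * (LINT y:ball01 x r|law. \<bar>energy_deriv law f y\<bar> powr p)"
proof -
  let ?B = "ball01 x r"
  define h g where "h = f \<circ> scaleU_inv law" and "g = weak_deriv01 h"
  have h01: "continuous_on {0..1} h"
    unfolding h_def using f scaleU_inv_range
    by (intro continuous_on_compose continuous_scaleU_inv) (auto simp: energy_domain_def intro: continuous_on_subset)
  then have h: "continuous_on {0<..<1} h" by (rule continuous_on_subset) auto
  have "sobolev01 p h" using f by (simp add: energy_domain_def h_def)
  note w = weak_deriv01_works[OF this h, folded g_def]
  have L: "L1_loc01 g" using w(1) by (simp add: has_weak_deriv01_def)
  have gm: "(\<lambda>x. indicator {0<..<1} x * g x) \<in> borel_measurable borel"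
    by (rule L1_loc01_measurable[OF L])
  \<comment> \<open>The weak derivative is arbitrary outside \<open>(0,1)\<close>; cut off outside \<open>[0,1]\<close>, it is a Borel function
    that agrees with the integrand of the energy everywhere on \<open>[0,1]\<close>.\<close>
  let ?G = "\<lambda>u. \<bar>indicator {0..1} u * g u\<bar> powr p"
  have "(\<lambda>u. indicator {0..1} u * g u) =
      (\<lambda>u. indicator {0<..<1} u * g u + g 0 * indicator {0} u + g 1 * indicator {1} u)"
    by (intro ext) (auto simp: indicator_def)
  moreover have "(\<lambda>u. indicator {0<..<1} u * g u + g 0 * indicator {0} u + g 1 * indicator {1} u)
      \<in> borel_measurable borel"
    using gm by measurable
  ultimately have [measurable]: "(\<lambda>u. indicator {0..1} u * g u) \<in> borel_measurable borel" by simp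
  have Gint: "integrable lborel ?G"
  proof (rule integrable_cong_AE_imp)
    show "integrable lborel (\<lambda>u. indicator {0<..<1} u *\<^sub>R \<bar>g u\<bar> powr p)"
      using w(2) by (simp add: set_integrable_def)
    show "AE u in lborel. indicator {0<..<1} u *\<^sub>R \<bar>g u\<bar> powr p = ?G u"
      using AE_lborel_singleton[of 0] AE_lborel_singleton[of 1]
      by eventually_elim (auto simp: indicator_def)
  qed simp
  have "(LINT y:?B|law. \<bar>energy_deriv law f y\<bar> powr p) = (LINT y:?B|law. ?G (F y))"
    unfolding set_lebesgue_integral_def
    by (intro Bochner_Integration.integral_cong refl)
      (use range_F in \<open>auto simp: space_law energy_deriv_def scaleU_law h_def g_def\<close>)
  also have "\<dots> = (LINT u:F ` ?B|lborel. ?G u)" by (rule integral_law[OF sets_ball]) simp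
  finally have eq: "(LINT y:?B|law. \<bar>energy_deriv law f y\<bar> powr p) = (LINT u:F ` ?B|lborel. ?G u)" .
  have *: "\<bar>f z - f y\<bar> powr p \<le> measure law ?B powr (p - 1) * (LINT u:F ` ?B|lborel. ?G u)"
    if yz: "y < z" "y \<in> ?B" "z \<in> ?B" "y \<in> {0<..<1}" "z \<in> {0<..<1}" for y z
  proof -
    have F: "0 < F y" "F y < F z" "F z < 1" using yz interior[of y] interior[of z] strict[of y z] by auto
    have sub: "{F y<..F z} \<subseteq> F ` ?B"
    proof
      fix u assume u: "u \<in> {F y<..F z}"
      then have u01: "u \<in> {0..1}" using F by auto
      define t where "t = scaleU_inv law u"
      have t: "t \<in> {0..1}" "F t = u" using scaleU_inv_range[OF u01] F_scaleU_inv[OF u01] by (simp_all add: t_def)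
      then have "y < t" using u strict_iff[of y t] yz by simp
      moreover have "\<not> z < t" using u t strict_iff[of z t] yz by simp
      ultimately have "t \<in> ?B" using yz t by (auto simp: ball01_def)
      then show "u \<in> F ` ?B" using t by auto
    qed
    have gint: "set_integrable lborel {F y<..F z} g"
      by (rule set_integrable_subset[OF L1_loc01_Icc[OF L F(1,3)]]) auto
    have gpint: "set_integrable lborel {F y<..F z} (\<lambda>u. \<bar>g u\<bar> powr p)"
      by (rule set_integrable_subset[OF w(2)]) (use F in auto)
    have "f z - f y = h (F z) - h (F y)" using yz by (simp add: h_def scaleU_inv_F)
    also have "\<dots> = (LINT u:{F y<..F z}|lborel. g u)" by (rule weak_deriv_increment[OF w(1) h F])
    finally have "\<bar>f z - f y\<bar> powr p \<le> (F z - F y) powr (p - 1) * (LINT u:{F y<..F z}|lborel. \<bar>g u\<bar> powr p)"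
      using integral_powr_le[OF F(2) p gint gpint] by simp
    also have "\<dots> \<le> measure law ?B powr (p - 1) * (LINT u:F ` ?B|lborel. ?G u)"
    proof (intro mult_mono powr_mono2)
      show "F z - F y \<le> measure law ?B"
        using yz by (intro measure_ge_F sets_ball) (auto simp: ball01_def)
      have "F ` ?B \<in> sets borel" by (rule borel_image_F[OF sets_ball])
      then have "integrable lborel (\<lambda>u. indicator (F ` ?B) u *\<^sub>R ?G u)"
        by (intro integrable_mult_indicator[OF _ Gint]) simp
      moreover have "(LINT u:{F y<..F z}|lborel. \<bar>g u\<bar> powr p) = (LINT u|lborel. indicator {F y<..F z} u *\<^sub>R ?G u)"
        unfolding set_lebesgue_integral_def using F
        by (intro Bochner_Integration.integral_cong refl) (auto simp: indicator_def)
      moreover have "(LINT u|lborel. indicator {F y<..F z} u *\<^sub>R ?G u) \<le> (LINT u|lborel. indicator (F ` ?B) u *\<^sub>R ?G u)"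
      proof (rule integral_mono)
        show "integrable lborel (\<lambda>u. indicator {F y<..F z} u *\<^sub>R ?G u)"
          by (rule integrable_mult_indicator[OF _ Gint]) simp
        show "integrable lborel (\<lambda>u. indicator (F ` ?B) u *\<^sub>R ?G u)" by fact
        show "indicator {F y<..F z} u *\<^sub>R ?G u \<le> indicator (F ` ?B) u *\<^sub>R ?G u" for u
          using sub by (intro scaleR_right_mono) (auto simp: indicator_def)
      qed
      ultimately show "(LINT u:{F y<..F z}|lborel. \<bar>g u\<bar> powr p) \<le> (LINT u:F ` ?B|lborel. ?G u)"
        unfolding set_lebesgue_integral_def[of lborel "F ` ?B"] by (simp only:)
      show "0 \<le> (LINT u:{F y<..F z}|lborel. \<bar>g u\<bar> powr p)"
        unfolding set_lebesgue_integral_def by (intro integral_nonneg_AE) auto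
    qed (use F p in auto)
    finally show ?thesis .
  qed
  have nn: "0 \<le> measure law ?B powr (p - 1) * (LINT u:F ` ?B|lborel. ?G u)"
    unfolding set_lebesgue_integral_def by (intro mult_nonneg_nonneg integral_nonneg_AE) auto
  consider "y < z" | "y = z" | "z < y" by linarith
  then show ?thesis
  proof cases
    case 1
    then show ?thesis using *[OF 1 y(1) z(1) y(2) z(2)] unfolding eq abs_minus_commute[of "f y" "f z"] by blast
  next
    case 2
    then have "\<bar>f y - f z\<bar> powr p = 0" by simp
    then show ?thesis using nn unfolding eq by (rule ord_eq_le_trans)
  next
    case 3
    then show ?thesis using *[OF 3 z(1) y(1) z(2) y(2)] unfolding eq by blast
  qed
qed

end

text \<open>
  The constant is the value of \<open>f\<close> at an interior point of the ball; the two endpoints of \<open>[0,1]\<close>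
  have measure zero.
\<close>

lemma poincare_ball:
  assumes "unit_cdf F" "unit_cdf G"
  defines "\<Lambda> \<equiv> unit_cdf.law F" and "\<mu> \<equiv> unit_cdf.law G"
  assumes f: "f \<in> energy_domain p \<Lambda>" and p: "1 < p" and x: "x \<in> {0..1}" and r: "0 < r"
  shows "(INF c. LINT y:ball01 x r|\<mu>. \<bar>f y - c\<bar> powr p) \<le>
    measure \<mu> (ball01 x r) * measure \<Lambda> (ball01 x r) powr (p - 1) *
      (LINT y:ball01 x r|\<Lambda>. \<bar>energy_deriv \<Lambda> f y\<bar> powr p)"
proof -
  interpret F: unit_cdf F by fact
  interpret G: unit_cdf G by fact
  let ?B = "ball01 x r"
  define M where "M = measure \<Lambda> ?B powr (p - 1) * (LINT y:?B|\<Lambda>. \<bar>energy_deriv \<Lambda> f y\<bar> powr p)"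
  have M: "0 \<le> M" unfolding M_def set_lebesgue_integral_def
    by (intro mult_nonneg_nonneg integral_nonneg_AE) auto
  \<comment> \<open>A point of the ball away from the endpoints: \<open>x\<close> is moved towards the centre of \<open>[0,1]\<close>.\<close>
  define z where "z = (if x \<le> 1/2 then x + min (r/2) (1/4) else x - min (r/2) (1/4))"
  have z: "z \<in> ?B" "z \<in> {0<..<1}" using x r by (auto simp: z_def ball01_def)
  have osc: "\<bar>f y - f z\<bar> powr p \<le> M" if "y \<in> ?B" "y \<in> {0<..<1}" for y
    unfolding M_def using F.oscillation_le[of f p r y x z] f p r that z by (simp add: \<Lambda>_def)
  interpret mu: prob_space \<mu> unfolding \<mu>_def by (rule G.prob_law)
  have B: "?B \<in> sets \<mu>" unfolding \<mu>_def by (rule G.sets_ball)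
  have "(INF c. LINT y:?B|\<mu>. \<bar>f y - c\<bar> powr p) \<le> (LINT y:?B|\<mu>. \<bar>f y - f z\<bar> powr p)"
  proof (rule cINF_lower)
    show "bdd_below (range (\<lambda>c. LINT y:?B|\<mu>. \<bar>f y - c\<bar> powr p))"
    proof (rule bdd_belowI2)
      show "0 \<le> (LINT y:?B|\<mu>. \<bar>f y - c\<bar> powr p)" for c
        unfolding set_lebesgue_integral_def by (intro integral_nonneg_AE) auto
    qed
  qed simp
  also have "\<dots> \<le> (LINT y:?B|\<mu>. M)"
  \<comment> \<open>A function that is not integrable has integral 0 by convention, and the right-hand side is nonnegative.\<close>
  proof (cases "set_integrable \<mu> ?B (\<lambda>y. \<bar>f y - f z\<bar> powr p)")
    case True
    have "AE y in \<mu>. y \<in> {0<..<1}" unfolding \<mu>_def by (rule G.AE_interior)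
    then have "AE y in \<mu>. indicator ?B y *\<^sub>R \<bar>f y - f z\<bar> powr p \<le> indicator ?B y *\<^sub>R M"
      by eventually_elim (use osc in \<open>auto simp: indicator_def\<close>)
    then show ?thesis
      using True B unfolding set_lebesgue_integral_def set_integrable_def
      by (intro integral_mono_AE) (auto simp: mu.emeasure_eq_measure)
  next
    case False
    then have "(LINT y:?B|\<mu>. \<bar>f y - f z\<bar> powr p) = 0"
      unfolding set_integrable_def set_lebesgue_integral_def by (rule not_integrable_integral_eq)
    then show ?thesis using M by (simp add: set_lebesgue_integral_def)
  qed
  also have "\<dots> = measure \<mu> ?B * M" using B by (simp add: set_lebesgue_integral_def)
  finally show ?thesis by (simp add: M_def mult.assoc)
qed

section \<open>Cutoff functions\<close>

definition ramp :: "real \<Rightarrow> real \<Rightarrow> real \<Rightarrow> real" where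
  "ramp a b u = max 0 (min 1 ((u - a) / (b - a)))"

lemma continuous_ramp: "a < b \<Longrightarrow> continuous_on A (ramp a b)"
  unfolding ramp_def[abs_def] by (intro continuous_intros) auto

lemma ramp_eq: "a < b \<Longrightarrow> u \<le> a \<Longrightarrow> ramp a b u = 0" "a < b \<Longrightarrow> b \<le> u \<Longrightarrow> ramp a b u = 1"
  by (auto simp: ramp_def divide_le_0_iff)

lemma ramp_derivative:
  assumes "a < b" "u \<notin> {a, b}"
  shows "(ramp a b has_real_derivative indicator {a<..<b} u / (b - a)) (at u)"
proof -
  consider "u < a" | "u \<in> {a<..<b}" | "b < u" using assms by fastforce
  then show ?thesis
  proof cases
    case 1
    show ?thesis
      by (rule has_field_derivative_transform_within_open[of "\<lambda>_. 0" _ _ "{..<a}"])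
        (use 1 assms in \<open>auto simp: ramp_eq\<close>)
  next
    case 2
    show ?thesis
    proof (rule has_field_derivative_transform_within_open[of "\<lambda>u. (u - a) / (b - a)" _ _ "{a<..<b}"])
      show "((\<lambda>u. (u - a) / (b - a)) has_real_derivative indicator {a<..<b} u / (b - a)) (at u)"
        using 2 by (auto intro!: derivative_eq_intros)
    qed (use 2 in \<open>auto simp: ramp_def field_simps max_def min_def\<close>)
  next
    case 3
    show ?thesis
      by (rule has_field_derivative_transform_within_open[of "\<lambda>_. 1" _ _ "{b<..}"])
        (use 3 assms in \<open>auto simp: ramp_eq\<close>)
  qed
qed

lemma ramp_energy:
  fixes a b p :: real
  assumes "a < b" "0 \<le> a" "b \<le> 1"
  shows "set_integrable lborel {0<..<1} (\<lambda>u. \<bar>indicator {a<..<b} u / (b - a)\<bar> powr p)"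
    and "(LINT u:{0<..<1}|lborel. \<bar>indicator {a<..<b} u / (b - a)\<bar> powr p) = (b - a) powr (1 - p)"
proof -
  have eq: "(\<lambda>u. indicator {0<..<1} u *\<^sub>R \<bar>indicator {a<..<b} u / (b - a)\<bar> powr p) =
      (\<lambda>u. indicator {a<..<b} u *\<^sub>R (1 / (b - a)) powr p)"
    using assms by (intro ext) (auto simp: indicator_def)
  show "set_integrable lborel {0<..<1} (\<lambda>u. \<bar>indicator {a<..<b} u / (b - a)\<bar> powr p)"
    unfolding set_integrable_def eq using assms by simp
  have "(LINT u:{0<..<1}|lborel. \<bar>indicator {a<..<b} u / (b - a)\<bar> powr p) = (b - a) * (1 / (b - a)) powr p"
    unfolding set_lebesgue_integral_def eq using assms by simp
  also have "\<dots> = (b - a) powr (1 - p)" using assms by (simp add: powr_diff powr_divide)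
  finally show "(LINT u:{0<..<1}|lborel. \<bar>indicator {a<..<b} u / (b - a)\<bar> powr p) = (b - a) powr (1 - p)" .
qed

text \<open>
  The cutoff is piecewise linear in the coordinate \<open>u = F y\<close>: a rising ramp to the left of the ball
  minus a second ramp to its right. Where the doubled ball leaves \<open>[0,1]\<close> there is nothing to cut
  off, and the ramp is replaced by the constant 1, respectively 0.
\<close>

lemma (in unit_cdf) cutoff:
  assumes p: "1 < p" and x: "x \<in> {0..1}" and r: "0 < r" and E: "0 \<le> E"
    and left_E: "0 \<le> x - 2 * r \<Longrightarrow> (F (x - r) - F (x - 2 * r)) powr (1 - p) \<le> E"
    and right_E: "x + 2 * r \<le> 1 \<Longrightarrow> (F (x + 2 * r) - F (x + r)) powr (1 - p) \<le> E"
  shows "\<exists>\<phi>\<in>energy_domain p law. (\<forall>y\<in>ball01 x r. \<phi> y = 1) \<and>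
    (\<forall>y\<in>{0..1} - ball01 x (2 * r). \<phi> y = 0) \<and> energy p law \<phi> \<le> 2 * E"
proof -
  define a b a' b' where "a = F (x - 2 * r)" and "b = F (x - r)"
    and "a' = F (x + r)" and "b' = F (x + 2 * r)"
  define ql qr where "ql \<longleftrightarrow> 0 \<le> x - 2 * r" and "qr \<longleftrightarrow> x + 2 * r \<le> 1"
  have ab: "0 \<le> a" "b \<le> 1" "a < b" if ql
    using that x r range_F[of "x - 2 * r"] range_F[of "x - r"] strict[of "x - 2 * r" "x - r"]
    by (auto simp: ql_def a_def b_def)
  have ab': "0 \<le> a'" "b' \<le> 1" "a' < b'" if qr
    using that x r range_F[of "x + 2 * r"] range_F[of "x + r"] strict[of "x + r" "x + 2 * r"]
    by (auto simp: qr_def a'_def b'_def)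
  have ba: "b \<le> a'" unfolding b_def a'_def using r by (intro mono) auto
  define L R where "L u = (if ql then ramp a b u else 1)" and "R u = (if qr then ramp a' b' u else 0)" for u
  define gL gR where "gL u = (if ql then indicator {a<..<b} u / (b - a) else 0 :: real)"
    and "gR u = (if qr then indicator {a'<..<b'} u / (b' - a') else 0 :: real)" for u
  define h g \<phi> where "h u = L u - R u" and "g u = gL u - gR u" and "\<phi> y = h (F y)" for u y
  define h' where "h' = \<phi> \<circ> scaleU_inv law"
  have h'_eq: "h' u = h u" if "u \<in> {0..1}" for u
    using F_scaleU_inv[OF that] by (simp add: h'_def \<phi>_def)
  have ch: "continuous_on A h" for A
    unfolding h_def[abs_def] L_def R_def using ab ab'
    by (cases ql; cases qr) (auto intro!: continuous_intros continuous_ramp)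
  have ch': "continuous_on {0..1} h'"
    using ch h'_eq by (subst continuous_on_cong[OF refl, of _ _ h]) auto
  have gm [measurable]: "g \<in> borel_measurable borel"
    unfolding g_def[abs_def] gL_def gR_def by measurable
  have wd: "has_weak_deriv01 h' g"
  proof (rule has_weak_deriv01_piecewise[of "{a, b, a', b'}"])
    fix u assume u: "u \<in> {0<..<1} - {a, b, a', b'}"
    have "(L has_real_derivative gL u) (at u)"
      using ramp_derivative[of a b u] ab u by (cases ql) (simp_all add: L_def[abs_def] gL_def)
    moreover have "(R has_real_derivative gR u) (at u)"
      using ramp_derivative[of a' b' u] ab' u by (cases qr) (simp_all add: R_def[abs_def] gR_def)
    ultimately have "(h has_real_derivative g u) (at u)"
      unfolding h_def[abs_def] g_def by (rule DERIV_diff)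
    then show "(h' has_real_derivative g u) (at u)"
      by (rule has_field_derivative_transform_within_open[of _ _ _ "{0<..<1}"])
        (use u h'_eq in auto)
  next
    show "\<bar>g u\<bar> \<le> 1 / \<bar>b - a\<bar> + 1 / \<bar>b' - a'\<bar>" for u
      using ba by (auto simp: g_def gL_def gR_def indicator_def)
  qed (auto intro: ch')
  let ?l = "\<lambda>u. \<bar>gL u\<bar> powr p" and ?r = "\<lambda>u. \<bar>gR u\<bar> powr p"
  \<comment> \<open>The two slopes live on disjoint intervals.\<close>
  have gp: "\<bar>g u\<bar> powr p = ?l u + ?r u" for u
    using ba p by (auto simp: g_def gL_def gR_def indicator_def)
  have il: "set_integrable lborel {0<..<1} ?l" "(LINT u:{0<..<1}|lborel. ?l u) \<le> E"
    using ramp_energy[of a b p] ab left_E E p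
    by (cases ql; simp add: gL_def ql_def a_def b_def set_integrable_def set_lebesgue_integral_def)+
  have ir: "set_integrable lborel {0<..<1} ?r" "(LINT u:{0<..<1}|lborel. ?r u) \<le> E"
    using ramp_energy[of a' b' p] ab' right_E E p
    by (cases qr; simp add: gR_def qr_def a'_def b'_def set_integrable_def set_lebesgue_integral_def)+
  have ig: "set_integrable lborel {0<..<1} (\<lambda>u. \<bar>g u\<bar> powr p)"
    unfolding gp by (rule set_integral_add(1)[OF il(1) ir(1)])
  have eg: "(LINT u:{0<..<1}|lborel. \<bar>g u\<bar> powr p) \<le> 2 * E"
    unfolding gp set_integral_add(2)[OF il(1) ir(1)] using il(2) ir(2) by simp
  have "set_integrable lborel {0..1} (\<lambda>u. \<bar>h' u\<bar> powr p)"
    using p by (intro borel_integrable_atLeastAtMost' continuous_on_powr' continuous_intros ch') auto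
  then have "set_integrable lborel {0<..<1} (\<lambda>u. \<bar>h' u\<bar> powr p)"
    by (rule set_integrable_subset) auto
  moreover have "set_borel_measurable lborel {0<..<1} h'"
  proof -
    have "set_integrable lborel {0..1} h'" by (rule borel_integrable_atLeastAtMost'[OF ch'])
    then have "set_integrable lborel {0<..<1} h'" by (rule set_integrable_subset) auto
    then show ?thesis unfolding set_integrable_def set_borel_measurable_def by blast
  qed
  ultimately have "Lp01 p h'" by (simp add: Lp01_def)
  moreover have "Lp01 p g" using ig by (simp add: Lp01_def set_borel_measurable_def)
  ultimately have sob: "sobolev01 p h'" using wd by (auto simp: sobolev01_def)
  have "continuous_on {0..1} \<phi>"
    unfolding \<phi>_def by (rule continuous_on_compose2[OF ch[of UNIV] continuous_on_F]) auto
  then have dom: "\<phi> \<in> energy_domain p law" using sob by (simp add: energy_domain_def h'_def)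
  have ch'0: "continuous_on {0<..<1} h'" by (rule continuous_on_subset[OF ch']) auto
  have wd': "has_weak_deriv01 h' (weak_deriv01 h')" by (rule weak_deriv01_works(1)[OF sob ch'0])
  have "energy p law \<phi> = (LINT u:{0<..<1}|lborel. \<bar>weak_deriv01 h' u\<bar> powr p)"
    by (simp add: energy_def h'_def)
  also have "\<dots> = (LINT u:{0<..<1}|lborel. \<bar>g u\<bar> powr p)"
    unfolding set_lebesgue_integral_def
  proof (rule integral_cong_AE)
    show "(\<lambda>u. indicator {0<..<1} u *\<^sub>R \<bar>weak_deriv01 h' u\<bar> powr p) \<in> borel_measurable lborel"
      using weak_deriv01_works(2)[OF sob ch'0] by (auto simp: set_integrable_def)
    show "AE u in lborel. indicator {0<..<1} u *\<^sub>R \<bar>weak_deriv01 h' u\<bar> powr p =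
        indicator {0<..<1} u *\<^sub>R \<bar>g u\<bar> powr p"
      using weak_deriv_unique[OF wd' wd ch'0] by eventually_elim (auto simp: indicator_def)
  qed measurable
  finally have en: "energy p law \<phi> \<le> 2 * E" using eg by simp
  have one: "\<phi> y = 1" if y: "y \<in> ball01 x r" for y
  proof -
    have "b \<le> F y" "F y \<le> a'" unfolding b_def a'_def using y by (auto intro!: mono simp: ball01_def)
    then show ?thesis using ab ab' by (simp add: \<phi>_def h_def L_def R_def ramp_eq)
  qed
  have zero: "\<phi> y = 0" if y: "y \<in> {0..1} - ball01 x (2 * r)" for y
  proof -
    have "y \<le> x - 2 * r \<or> x + 2 * r \<le> y" using y by (auto simp: ball01_def)
    then show ?thesis
    proof
      assume *: "y \<le> x - 2 * r"
      then have "ql" "F y \<le> a" using y by (auto simp: ql_def a_def intro: mono)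
      moreover have "F y \<le> a'" unfolding a'_def using * r by (intro mono) auto
      ultimately show ?thesis using ab ab' by (simp add: \<phi>_def h_def L_def R_def ramp_eq)
    next
      assume *: "x + 2 * r \<le> y"
      then have "qr" "b' \<le> F y" using y by (auto simp: qr_def b'_def intro: mono)
      moreover have "b \<le> F y" unfolding b_def using * r by (intro mono) auto
      ultimately show ?thesis using ab ab' by (simp add: \<phi>_def h_def L_def R_def ramp_eq)
    qed
  qed
  show ?thesis using dom one zero en by blast
qed

section \<open>Triadic cascades\<close>

text \<open>
  All fractions passed on to children are at least \<open>\<delta>\<close>, hence at most \<open>1 - \<delta>\<close>: the lower bound
  yields full support and doubling, the upper bound excludes atoms.
\<close>

locale cascade =
  fixes u :: "nat \<Rightarrow> real" and \<delta> :: real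
  assumes delta_pos: "0 < \<delta>"
    and delta_le: "\<And>n. \<delta> \<le> u n"
    and u_le: "\<And>n. 2 * u n + \<delta> \<le> 1"
begin

text \<open>
  The fraction of the mass of a cell that goes to its child \<open>d\<close> in \<open>{0,1,2}\<close>.
\<close>

definition weight :: "nat \<Rightarrow> nat \<Rightarrow> real" where
  "weight n d = (if d = 1 then 1 - 2 * u n else u n)"

text \<open>
  Cell \<open>k\<close> of generation \<open>n\<close> is the interval between \<open>k/3\<^sup>n\<close> and \<open>(k+1)/3\<^sup>n\<close>. Indices \<open>k \<ge> 3\<^sup>n\<close> get
  mass 0, which makes the cumulative sums constant to the right of 1.
\<close>

fun mass :: "nat \<Rightarrow> nat \<Rightarrow> real" where
  "mass 0 k = (if k = 0 then 1 else 0)"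
| "mass (Suc n) k = mass n (k div 3) * weight n (k mod 3)"

definition cum :: "nat \<Rightarrow> nat \<Rightarrow> real" where
  "cum n k = (\<Sum>j<k. mass n j)"

text \<open>
  The mass of all cells of generation \<open>n\<close> to the left of \<open>x\<close> increases with \<open>n\<close>, so that the
  supremum is the limit.
\<close>

definition cdf :: "real \<Rightarrow> real" where
  "cdf x = (SUP n. cum n (nat \<lfloor>x * 3 ^ n\<rfloor>))"

lemma weight_bounds: "\<delta> \<le> weight n d" "weight n d \<le> 1 - \<delta>"
  using delta_pos delta_le[of n] u_le[of n] by (auto simp: weight_def)

lemma delta_less_1: "\<delta> < 1"
  using delta_pos delta_le[of 0] u_le[of 0] by linarith

lemma mass_nonneg: "0 \<le> mass n k"
proof (induction n arbitrary: k)
  case (Suc n)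
  have "0 \<le> weight n (k mod 3)" using weight_bounds(1)[of n "k mod 3"] delta_pos by linarith
  then show ?case using Suc by simp
qed simp

lemma mass_upper: "mass n k \<le> (1 - \<delta>) ^ n"
proof (induction n arbitrary: k)
  case (Suc n)
  have "0 \<le> weight n (k mod 3)" using weight_bounds(1)[of n "k mod 3"] delta_pos by linarith
  then have "mass n (k div 3) * weight n (k mod 3) \<le> (1 - \<delta>) ^ n * (1 - \<delta>)"
    using delta_less_1 by (intro mult_mono Suc weight_bounds) auto
  then show ?case by (simp add: mult.commute)
qed simp

lemma mass_lower: "k < 3 ^ n \<Longrightarrow> \<delta> ^ n \<le> mass n k"
proof (induction n arbitrary: k)
  case (Suc n)
  have "\<delta> ^ n * \<delta> \<le> mass n (k div 3) * weight n (k mod 3)"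
    using delta_pos Suc.prems
    by (intro mult_mono Suc.IH weight_bounds mass_nonneg) auto
  then show ?case by (simp add: mult.commute)
qed simp

lemma mass_pos: "k < 3 ^ n \<Longrightarrow> 0 < mass n k"
  using mass_lower[of k n] delta_pos by (meson less_le_trans zero_less_power)

lemma mass_outside: "3 ^ n \<le> k \<Longrightarrow> mass n k = 0"
proof (induction n arbitrary: k)
  case (Suc n)
  then have "3 ^ n \<le> k div 3" by (simp add: less_eq_div_iff_mult_less_eq mult.commute)
  then show ?case using Suc.IH by simp
qed simp

lemma mass_descendant: "\<delta> ^ m * mass n (k div 3 ^ m) \<le> mass (n + m) k"
proof (induction m arbitrary: k)
  case (Suc m)
  have "\<delta> ^ m * mass n (k div 3 div 3 ^ m) * \<delta> \<le> mass (n + m) (k div 3) * weight (n + m) (k mod 3)"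
    using delta_pos by (intro mult_mono Suc.IH weight_bounds mass_nonneg) auto
  then show ?case by (simp add: div_mult2_eq mult_ac)
qed simp

text \<open>
  Two adjacent cells either share their parent, and then their masses differ by a ratio of weights;
  or they are the last and the first child of adjacent parents, and then both receive the same
  fraction \<open>u n\<close>, so the ratio of the parents is inherited.
\<close>

lemma mass_adjacent:
  "Suc k < 3 ^ n \<Longrightarrow> \<delta> * mass n (Suc k) \<le> mass n k \<and> \<delta> * mass n k \<le> mass n (Suc k)"
proof (induction n arbitrary: k)
  case (Suc n)
  show ?case
  proof (cases "k mod 3 = 2")
    case True
    then have d: "Suc k div 3 = Suc (k div 3)" "Suc k mod 3 = 0" by presburger+
    have w: "weight n (Suc k mod 3) = u n" "weight n (k mod 3) = u n"
      using True d by (simp_all add: weight_def)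
    have u: "0 \<le> u n" using delta_pos delta_le[of n] by linarith
    have "Suc (k div 3) < 3 ^ n" using Suc.prems d(1) True by simp
    from Suc.IH[OF this] u show ?thesis
      by (simp add: w d(1)) (metis mult.assoc mult_right_mono)
  next
    case False
    then have d: "Suc k div 3 = k div 3" by presburger
    have *: "\<delta> * weight n a \<le> weight n b" for a b
      using weight_bounds[of n a] weight_bounds[of n b] delta_pos delta_less_1
      by (smt (verit, best) mult_left_le)
    show ?thesis
      using mult_left_mono[OF *[of "Suc k mod 3" "k mod 3"] mass_nonneg[of n "k div 3"]]
        mult_left_mono[OF *[of "k mod 3" "Suc k mod 3"] mass_nonneg[of n "k div 3"]]
      by (simp add: d mult_ac)
  qed
qed simp

lemma mass_near:
  "i < 3 ^ n \<Longrightarrow> j < 3 ^ n \<Longrightarrow> i \<le> j + d \<Longrightarrow> j \<le> i + d \<Longrightarrow> \<delta> ^ d * mass n i \<le> mass n j"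
proof (induction d arbitrary: i)
  case (Suc d)
  consider "i = j + Suc d" | "j = i + Suc d" | "i \<le> j + d" "j \<le> i + d" using Suc.prems by linarith
  then show ?case
  proof cases
    case 1
    have "\<delta> * mass n i \<le> mass n (i - 1)" using mass_adjacent[of "i - 1" n] 1 Suc.prems by simp
    moreover have "\<delta> ^ d * mass n (i - 1) \<le> mass n j" using Suc.prems 1 by (intro Suc.IH) auto
    ultimately show ?thesis using delta_pos
      by (smt (verit, best) mult.assoc mult.commute mult_left_mono power_Suc zero_less_power)
  next
    case 2
    have "\<delta> * mass n i \<le> mass n (Suc i)" using mass_adjacent[of "i" n] 2 Suc.prems by simp
    moreover have "\<delta> ^ d * mass n (Suc i) \<le> mass n j" using Suc.prems 2 by (intro Suc.IH) auto
    ultimately show ?thesis using delta_pos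
      by (smt (verit, best) mult.assoc mult.commute mult_left_mono power_Suc zero_less_power)
  next
    case 3
    have "\<delta> * (\<delta> ^ d * mass n i) \<le> 1 * (\<delta> ^ d * mass n i)"
      using delta_less_1 delta_pos mass_nonneg[of n i] by (intro mult_right_mono) auto
    also have "\<dots> \<le> mass n j" using Suc.IH[OF Suc.prems(1,2) 3] by simp
    finally show ?thesis by (simp add: mult_ac)
  qed
qed simp

lemma cum_refine: "cum (Suc n) (3 * k) = cum n k"
proof (induction k)
  case (Suc k)
  have e: "3 * Suc k = Suc (Suc (Suc (3 * k)))" by simp
  have d: "Suc (3 * k) div 3 = k" "Suc (3 * k) mod 3 = 1"
    "Suc (Suc (3 * k)) div 3 = k" "Suc (Suc (3 * k)) mod 3 = 2" by presburger+
  have "cum (Suc n) (3 * Suc k) = cum (Suc n) (3 * k) +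
      mass n k * (weight n 0 + weight n 1 + weight n 2)"
    unfolding e cum_def sum.lessThan_Suc by (simp add: d distrib_left)
  also have "weight n 0 + weight n 1 + weight n 2 = 1" by (simp add: weight_def)
  finally show ?case using Suc by (simp add: cum_def)
qed (simp add: cum_def)

lemma cum_refine_power: "cum (n + m) (3 ^ m * k) = cum n k"
  by (induction m) (simp_all add: cum_refine mult.assoc)

lemma cum_mono: "i \<le> j \<Longrightarrow> cum n i \<le> cum n j"
  unfolding cum_def by (intro sum_mono2) (auto simp: mass_nonneg)

lemma cum_nonneg: "0 \<le> cum n k" by (simp add: cum_def sum_nonneg mass_nonneg)

lemma cum_full: "3 ^ n \<le> k \<Longrightarrow> cum n k = 1"
proof -
  assume k: "3 ^ n \<le> k"
  have "cum n k = cum n (3 ^ n)"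
    unfolding cum_def using k by (intro sum.mono_neutral_right) (auto simp: mass_outside)
  also have "\<dots> = cum 0 1" using cum_refine_power[of 0 n 1] by simp
  also have "\<dots> = 1" by (simp add: cum_def)
  finally show ?thesis .
qed

lemma cum_le_1: "cum n k \<le> 1"
  using cum_mono[of k "max k (3 ^ n)" n] cum_full[of n "max k (3 ^ n)"] by simp

lemma cum_bdd: "bdd_above (range (\<lambda>n. cum n (g n)))"
  by (rule bdd_aboveI[of _ 1]) (auto simp: cum_le_1)

lemma cdf_ge: "cum n (nat \<lfloor>x * 3 ^ n\<rfloor>) \<le> cdf x"
  unfolding cdf_def by (rule cSUP_upper[OF _ cum_bdd]) simp

lemma cdf_mono: "x \<le> y \<Longrightarrow> cdf x \<le> cdf y"
  unfolding cdf_def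
  by (intro cSUP_mono cum_bdd) (auto intro!: cum_mono nat_mono floor_mono mult_right_mono exI)

lemma cdf_triadic: "cdf (real k / 3 ^ n) = cum n k"
proof (rule antisym)
  show "cdf (real k / 3 ^ n) \<le> cum n k"
    unfolding cdf_def
  proof (rule cSUP_least)
    fix m :: nat
    let ?a = "nat \<lfloor>real k / 3 ^ n * 3 ^ m\<rfloor>"
    have "real ?a \<le> real k / 3 ^ n * 3 ^ m" by (simp add: of_nat_floor)
    then have "real ?a * 3 ^ n \<le> real k / 3 ^ n * 3 ^ m * 3 ^ n" by (intro mult_right_mono) auto
    then have "real ?a * 3 ^ n \<le> real k * 3 ^ m" by simp
    then have "real (3 ^ n * ?a) \<le> real (3 ^ m * k)" by (simp add: mult.commute)
    then have "3 ^ n * ?a \<le> 3 ^ m * k" by (simp only: of_nat_le_iff)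
    then have "cum (m + n) (3 ^ n * ?a) \<le> cum (n + m) (3 ^ m * k)"
      using cum_mono by (simp add: add.commute)
    then show "cum m ?a \<le> cum n k" by (simp only: cum_refine_power)
  qed simp
  show "cum n k \<le> cdf (real k / 3 ^ n)" using cdf_ge[of n "real k / 3 ^ n"] by simp
qed

lemma cdf_nonpos: "x \<le> 0 \<Longrightarrow> cdf x = 0"
proof -
  assume x: "x \<le> 0"
  have "nat \<lfloor>x * 3 ^ n\<rfloor> = 0" for n
    using x by (simp add: floor_le_zero mult_nonpos_nonneg le_less_trans[of _ 0])
  then show ?thesis by (simp add: cdf_def cum_def)
qed

lemma cdf_ge_1: "1 \<le> x \<Longrightarrow> cdf x = 1"
proof -
  assume x: "1 \<le> x"
  have "3 ^ n \<le> nat \<lfloor>x * 3 ^ n\<rfloor>" for n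
  proof -
    have "(1::real) * 3 ^ n \<le> x * 3 ^ n" using x by (intro mult_right_mono) auto
    then have "(3 ^ n :: int) \<le> \<lfloor>x * 3 ^ n\<rfloor>" by (simp add: le_floor_iff)
    then show ?thesis by (simp add: nat_le_iff le_nat_iff)
  qed
  then show ?thesis by (simp add: cdf_def cum_full)
qed

lemma cdf_step: "x \<le> y \<Longrightarrow> y - x \<le> 1 / 3 ^ n \<Longrightarrow> cdf y - cdf x \<le> 2 * (1 - \<delta>) ^ n"
proof -
  assume xy: "x \<le> y" "y - x \<le> 1 / 3 ^ n"
  define k where "k = nat \<lfloor>x * 3 ^ n\<rfloor>"
  have "cum n k \<le> cdf x" unfolding k_def by (rule cdf_ge)
  moreover have "x * 3 ^ n \<le> real k + 1" unfolding k_def by linarith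
  then have "x \<le> (real k + 1) / 3 ^ n" by (simp add: field_simps)
  then have "y \<le> (real k + 1) / 3 ^ n + 1 / 3 ^ n" using xy by linarith
  then have "y \<le> real (k + 2) / 3 ^ n" by (simp add: field_simps)
  then have "cdf y \<le> cum n (k + 2)" using cdf_mono cdf_triadic by metis
  moreover have "cum n (k + 2) = cum n k + mass n k + mass n (Suc k)" by (simp add: cum_def)
  ultimately show ?thesis using mass_upper[of n k] mass_upper[of n "Suc k"] by linarith
qed

lemma cdf_continuous: "isCont cdf x"
  unfolding continuous_at_eps_delta
proof (intro allI impI)
  fix e :: real assume e: "0 < e"
  have "(\<lambda>n. 2 * (1 - \<delta>) ^ n) \<longlonglongrightarrow> 2 * 0"
    using delta_pos delta_less_1 by (intro tendsto_intros LIMSEQ_power_zero) auto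
  then have "\<forall>\<^sub>F n in sequentially. 2 * (1 - \<delta>) ^ n < e" using e by (intro order_tendstoD) auto
  then obtain n where n: "2 * (1 - \<delta>) ^ n < e" by (auto simp: eventually_sequentially)
  have "\<bar>cdf y - cdf x\<bar> < e" if "\<bar>y - x\<bar> < 1 / 3 ^ n" for y
    using cdf_step[of x y n] cdf_step[of y x n] cdf_mono[of x y] cdf_mono[of y x] that n
    by linarith
  then show "\<exists>d>0. \<forall>y. dist y x < d \<longrightarrow> dist (cdf y) (cdf x) < e"
    by (intro exI[of _ "1 / 3 ^ n"]) (auto simp: dist_real_def)
qed

lemma contains_triadic:
  assumes "0 \<le> s" "t \<le> 1" "2 / 3 ^ n \<le> t - s"
  obtains i where "i < 3 ^ n" "s \<le> real i / 3 ^ n" "real (Suc i) / 3 ^ n \<le> t"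
    "mass n i \<le> cdf t - cdf s"
proof -
  define i where "i = nat \<lceil>s * 3 ^ n\<rceil>"
  have i: "s * 3 ^ n \<le> real i" "real i \<le> s * 3 ^ n + 1"
    unfolding i_def using assms(1) by (auto simp: of_nat_ceiling) 
  have "s \<le> real i / 3 ^ n" using i(1) by (simp add: field_simps)
  moreover have "real (Suc i) \<le> t * 3 ^ n" using i(2) assms(3) by (simp add: field_simps)
  then have t: "real (Suc i) / 3 ^ n \<le> t" by (simp add: field_simps)
  moreover have "real (Suc i) / 3 ^ n \<le> 1" using t assms(2) by linarith
  then have "real (Suc i) \<le> real (3 ^ n)" by (simp add: field_simps)
  then have "i < 3 ^ n" by (simp only: of_nat_le_iff Suc_le_eq)
  moreover have "mass n i \<le> cdf t - cdf s"
    using cdf_mono[OF t] cdf_mono[OF \<open>s \<le> real i / 3 ^ n\<close>] unfolding cdf_triadic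
    by (simp add: cum_def)
  ultimately show ?thesis using that by blast
qed

lemma cdf_strict: "0 \<le> s \<Longrightarrow> s < t \<Longrightarrow> t \<le> 1 \<Longrightarrow> cdf s < cdf t"
proof -
  assume st: "0 \<le> s" "s < t" "t \<le> 1"
  obtain n where "(1/3::real) ^ n < (t - s) / 2"
    using real_arch_pow_inv[of "(t - s) / 2" "1/3"] st by auto
  then have "2 / 3 ^ n \<le> t - s" by (simp add: power_one_over field_simps)
  then obtain i where "i < 3 ^ n" "mass n i \<le> cdf t - cdf s"
    using contains_triadic st by metis
  then show ?thesis using mass_pos[of i n] by linarith
qed

text \<open>
  A ball of radius at most \<open>3\<^sup>-\<^sup>n\<close> centred in cell \<open>j\<close> stays inside that cell and its two
  neighbours.
\<close>

lemma cdf_upper: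
  assumes "real j \<le> x * 3 ^ n" "x * 3 ^ n \<le> real j + 1" "j < 3 ^ n" "r \<le> 1 / 3 ^ n"
  shows "\<delta> * (cdf (x + r) - cdf (x - r)) \<le> 3 * mass n j"
proof -
  have r: "r * 3 ^ n \<le> 1" using assms(4) by (simp add: field_simps)
  have "(x + r) * 3 ^ n \<le> real (j + 2)" using assms(2) r by (simp add: algebra_simps)
  then have "x + r \<le> real (j + 2) / 3 ^ n" by (simp add: field_simps)
  then have a: "cdf (x + r) \<le> cum n (j + 2)" using cdf_mono cdf_triadic by metis
  have b: "cum n (j - 1) \<le> cdf (x - r)"
  proof (cases "j = 0")
    case True
    then show ?thesis
      by (simp add: cum_def) (metis cdf_ge cum_nonneg order_trans)
  next
    case False
    then have "real (j - 1) \<le> (x - r) * 3 ^ n" using assms(1) r by (simp add: algebra_simps)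
    then have "real (j - 1) / 3 ^ n \<le> x - r" by (simp add: field_simps)
    then show ?thesis using cdf_mono cdf_triadic by metis
  qed
  have c: "\<delta> * mass n (Suc j) \<le> mass n j"
    using mass_adjacent[of j n] mass_outside[of n "Suc j"] mass_nonneg[of n j]
    by (cases "Suc j < 3 ^ n") auto
  have d: "\<delta> * mass n j \<le> mass n j"
    using delta_less_1 mass_nonneg[of n j] delta_pos by (simp add: mult_left_le_one_le)
  have "\<delta> * (cum n (j + 2) - cum n (j - 1)) \<le> 3 * mass n j"
  proof (cases j)
    case 0
    then show ?thesis using c d mass_nonneg[of n j] by (simp add: cum_def algebra_simps)
  next
    case (Suc i)
    then have "\<delta> * mass n i \<le> mass n j" using mass_adjacent[of i n] assms(3) by simp
    then show ?thesis using c d Suc by (simp add: cum_def algebra_simps)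
  qed
  moreover have "\<delta> * (cdf (x + r) - cdf (x - r)) \<le> \<delta> * (cum n (j + 2) - cum n (j - 1))"
    using a b delta_pos by (intro mult_left_mono) auto
  ultimately show ?thesis by linarith
qed

text \<open>
  An interval of length \<open>3\<^sup>-\<^sup>n\<^sup>-\<^sup>2\<close> contains a cell of generation \<open>n + 3\<close>. Near \<open>x\<close>, its ancestor of
  generation \<open>n\<close> is at most three cells away from \<open>j\<close>; three generations and three neighbours cost a
  factor \<open>\<delta>\<close> each.
\<close>

lemma cdf_lower:
  assumes "real j \<le> x * 3 ^ n" "x * 3 ^ n \<le> real j + 1" "j < 3 ^ n"
    and "0 \<le> s" "t \<le> 1" "1 / 3 ^ (n + 2) \<le> t - s" "x - 2 / 3 ^ n \<le> s" "t \<le> x + 2 / 3 ^ n"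
  shows "\<delta> ^ 6 * mass n j \<le> cdf t - cdf s"
proof -
  have "2 / 3 ^ (n + 3) \<le> t - s" using assms(6) by (simp add: field_simps power_add)
  then obtain i where i: "i < 3 ^ (n + 3)" "s \<le> real i / 3 ^ (n + 3)"
      "real (Suc i) / 3 ^ (n + 3) \<le> t" "mass (n + 3) i \<le> cdf t - cdf s"
    using contains_triadic assms(4,5) by metis
  define X where "X = x * 3 ^ n"
  define k where "k = i div 3 ^ 3"
  have k: "k < 3 ^ n" using i(1) by (simp add: k_def power_add) 
  have k1: "27 * real k \<le> real i"
  proof -
    have "27 * k \<le> i" by (simp add: k_def)
    then have "real (27 * k) \<le> real i" by (simp only: of_nat_le_iff)
    then show ?thesis by simp
  qed
  have k2: "real i < 27 * (real k + 1)"
  proof -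
    have "i < 27 * (k + 1)" unfolding k_def by simp
    then have "real i < real (27 * (k + 1))" by (simp only: of_nat_less_iff)
    then show ?thesis by simp
  qed
  have p: "(3::real) ^ (n + 3) = 27 * 3 ^ n" by (simp add: power_add)
  have "real (Suc i) / (27 * 3 ^ n) \<le> x + 2 / 3 ^ n"
    using i(3) assms(8) unfolding p by linarith
  then have "real (Suc i) \<le> (x + 2 / 3 ^ n) * (27 * 3 ^ n)" by (subst (asm) pos_divide_le_eq) auto
  then have "real (Suc i) \<le> 27 * X + 54" by (simp add: X_def algebra_simps)
  then have "real k < real j + 4" using k1 assms(2)[folded X_def] by linarith
  moreover have "x - 2 / 3 ^ n \<le> real i / (27 * 3 ^ n)" using i(2) assms(7) unfolding p by linarith
  then have "(x - 2 / 3 ^ n) * (27 * 3 ^ n) \<le> real i" by (subst (asm) pos_le_divide_eq) auto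
  then have "27 * X - 54 \<le> real i" by (simp add: X_def algebra_simps)
  then have "27 * X < 27 * real k + 81" using k2 by (simp add: algebra_simps)
  then have "X < real k + 4" by simp
  then have "real j < real k + 4" using assms(1)[folded X_def] by (rule le_less_trans[rotated])
  ultimately have "\<delta> ^ 3 * mass n j \<le> mass n k" using k assms(3) by (intro mass_near) auto
  then have "\<delta> ^ 3 * (\<delta> ^ 3 * mass n j) \<le> \<delta> ^ 3 * mass n k"
    using delta_pos by (intro mult_left_mono) auto
  also have "\<dots> \<le> mass (n + 3) i" unfolding k_def by (rule mass_descendant)
  also note i(4)
  finally show ?thesis by (simp add: mult.assoc[symmetric] power_add[symmetric])
qed

end

lemma (in cascade) unit_cdf_cdf: "unit_cdf cdf"
  by unfold_locales (auto intro: cdf_mono cdf_continuous cdf_nonpos cdf_ge_1 cdf_strict)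

sublocale cascade \<subseteq> unit_cdf cdf
  by (rule unit_cdf_cdf)

lemma triadic_cell:
  fixes x :: real
  assumes "x \<in> {0..1}"
  obtains j :: nat where "real j \<le> x * 3 ^ n" "x * 3 ^ n \<le> real j + 1" "j < 3 ^ n"
proof (cases "x = 1")
  case True
  have "real (3 ^ n - 1) = 3 ^ n - 1" by (simp add: of_nat_diff)
  then show ?thesis using True that[of "3 ^ n - 1"] by simp
next
  case False
  then have x: "0 \<le> x" "x < 1" using assms by auto
  have "real (nat \<lfloor>x * 3 ^ n\<rfloor>) \<le> x * 3 ^ n" using x by (simp add: of_nat_floor)
  moreover have "x * 3 ^ n \<le> real (nat \<lfloor>x * 3 ^ n\<rfloor>) + 1" by linarith
  moreover have "x * 3 ^ n < 1 * 3 ^ n" using x by (intro mult_strict_right_mono) auto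
  with calculation(1) have "real (nat \<lfloor>x * 3 ^ n\<rfloor>) < 3 ^ n" by linarith
  then have "nat \<lfloor>x * 3 ^ n\<rfloor> < 3 ^ n" by (simp only: of_nat_less_numeral_power_cancel_iff)
  ultimately show ?thesis using that by blast
qed

text \<open>
  The exceptional case \<open>n = 0\<close> covers radii above 1, where the ball is all of \<open>[0,1]\<close>.
\<close>

lemma triadic_level:
  fixes r :: real
  assumes "0 < r"
  obtains n :: nat where "1 / 3 ^ Suc n \<le> r" "r \<le> 1 / 3 ^ n \<or> n = 0"
proof -
  have "\<exists>n. 1 / 3 ^ Suc n \<le> r"
  proof -
    obtain n where "(1/3 :: real) ^ n < r" using real_arch_pow_inv[of r "1/3"] assms by auto
    then have "1 / 3 ^ Suc n \<le> r" using assms by (simp add: power_one_over field_simps)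
    then show ?thesis by blast
  qed
  define n where "n = (LEAST n. 1 / 3 ^ Suc n \<le> r)"
  have 1: "1 / 3 ^ Suc n \<le> r" unfolding n_def by (rule LeastI_ex) fact
  have "r \<le> 1 / 3 ^ n" if "n = Suc m" for m
    using not_less_Least[of m "\<lambda>n. 1 / 3 ^ Suc n \<le> r"] that unfolding n_def[symmetric] by simp
  then have "r \<le> 1 / 3 ^ n \<or> n = 0" by (cases n) auto
  with 1 show ?thesis using that by blast
qed

context cascade begin

lemma ball_upper:
  assumes j: "real j \<le> x * 3 ^ n" "x * 3 ^ n \<le> real j + 1" "j < 3 ^ n"
    and r: "0 < r" "r \<le> 1 / 3 ^ n \<or> n = 0"
  shows "\<delta> * measure law (ball01 x r) \<le> 3 * mass n j"
  using r(2)
proof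
  assume "r \<le> 1 / 3 ^ n"
  then have "\<delta> * (cdf (x + r) - cdf (x - r)) \<le> 3 * mass n j" by (rule cdf_upper[OF j])
  moreover have "measure law (ball01 x r) \<le> cdf (x + r) - cdf (x - r)"
    using r(1) by (intro measure_le_F sets_ball) (auto simp: ball01_def)
  ultimately show ?thesis using delta_pos by (meson mult_left_mono less_imp_le order_trans)
next
  assume n: "n = 0"
  interpret prob_space law by (rule prob_law)
  have "\<delta> * measure law (ball01 x r) \<le> 1 * 1"
    using delta_pos delta_less_1 by (intro mult_mono) auto
  then show ?thesis using j(3) n by simp
qed

text \<open>
  Even at an endpoint of \<open>[0,1]\<close>, the ball contains an interval of length \<open>3\<^sup>-\<^sup>n\<^sup>-\<^sup>2\<close> with endpoint
  \<open>x\<close>, chosen on the side of \<open>x\<close> where there is room.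
\<close>

lemma ball_lower:
  assumes j: "real j \<le> x * 3 ^ n" "x * 3 ^ n \<le> real j + 1" "j < 3 ^ n" and x: "x \<in> {0..1}"
    and r: "1 / 3 ^ Suc n \<le> 2 * r"
  shows "\<delta> ^ 6 * mass n j \<le> measure law (ball01 x r)"
proof -
  define l :: real where "l = 1 / 3 ^ (n + 2)"
  define s t where "s = (if x \<le> 1/2 then x else x - l)" and "t = (if x \<le> 1/2 then x + l else x)"
  have l: "0 < l" "l \<le> 1/9" "l < r" "l \<le> 2 / 3 ^ n"
  proof -
    have "(1::real) / 3 ^ (n + 2) \<le> 1 / 3 ^ 2" by (intro divide_left_mono power_increasing) auto
    then show "l \<le> 1/9" by (simp add: l_def)
    have "3 * l \<le> 2 * r" using r by (simp add: l_def)
    moreover show "0 < l" by (simp add: l_def)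
    ultimately show "l < r" by linarith
    show "l \<le> 2 / 3 ^ n" by (simp add: l_def field_simps)
  qed
  have st: "0 \<le> s" "t \<le> 1" "t - s = l" "x - l \<le> s" "t \<le> x + l"
    using l x by (auto simp: s_def t_def)
  have "\<delta> ^ 6 * mass n j \<le> cdf t - cdf s"
  proof (rule cdf_lower[OF j st(1,2)])
    show "1 / 3 ^ (n + 2) \<le> t - s" using st(3) unfolding l_def by (rule eq_refl[OF sym])
  qed (use st l in linarith)+
  also have "\<dots> \<le> measure law (ball01 x r)"
    using st l by (intro measure_ge_F sets_ball) (auto simp: ball01_def s_def t_def)
  finally show ?thesis .
qed

lemma doubling_law: "doubling01 law"
  unfolding doubling01_def
proof (intro conjI radon_law exI[of _ "3 / \<delta> ^ 7"] ballI allI impI)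
  show "0 < 3 / \<delta> ^ 7" using delta_pos by simp
  fix x r :: real assume x: "x \<in> {0..1}" and r: "0 < r"
  obtain n where n: "1 / 3 ^ Suc n \<le> 2 * r" "2 * r \<le> 1 / 3 ^ n \<or> n = 0"
    using triadic_level[of "2 * r"] r by auto
  obtain j where j: "real j \<le> x * 3 ^ n" "x * 3 ^ n \<le> real j + 1" "j < 3 ^ n"
    using triadic_cell[OF x] .
  have up: "\<delta> * measure law (ball01 x (2 * r)) \<le> 3 * mass n j"
    using ball_upper[OF j _ n(2)] r by simp
  have lo: "\<delta> ^ 6 * mass n j \<le> measure law (ball01 x r)" by (rule ball_lower[OF j x n(1)])
  have "\<delta> ^ 7 * measure law (ball01 x (2 * r)) = \<delta> ^ 6 * (\<delta> * measure law (ball01 x (2 * r)))"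
    by (simp add: power_Suc[symmetric] mult.assoc[symmetric] power_Suc2[symmetric] del: power_Suc)
  also have "\<dots> \<le> \<delta> ^ 6 * (3 * mass n j)" using up delta_pos by (intro mult_left_mono) auto
  also have "\<dots> \<le> 3 * measure law (ball01 x r)" using lo by simp
  finally show "measure law (ball01 x (2 * r)) \<le> 3 / \<delta> ^ 7 * measure law (ball01 x r)"
    using delta_pos by (simp add: field_simps)
  have "0 < \<delta> ^ 6 * mass n j" using delta_pos mass_pos[OF j(3)] by simp
  also have "\<dots> \<le> measure law (ball01 x (2 * r))" using n(1) r by (intro ball_lower[OF j x]) auto
  finally show "0 < measure law (ball01 x (2 * r))" .
qed

end

section \<open>Two balanced cascades\<close>

text \<open>
  Eliminate \<open>v = \<kappa> / u\<^sup>p\<^sup>-\<^sup>1\<close> and apply the intermediate value theorem to the remaining equation for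
  \<open>u\<close>. At \<open>u = 1/3\<close> the middle third has at least the product \<open>\<kappa>\<close>, because \<open>\<kappa> \<le> 3\<^sup>-\<^sup>p\<close>. At the point
  \<open>u\<^sub>0\<close> where \<open>v\<close> reaches \<open>1/2\<close> the middle third gets nothing. The bound \<open>\<delta>\<close> on all fractions
  depends only on \<open>p\<close> and on the lower bound \<open>c\<close> for \<open>\<kappa>\<close>.
\<close>

lemma weights_exist:
  fixes p \<kappa> c :: real
  assumes p: "1 < p" and c: "0 < c" and \<kappa>: "c \<le> \<kappa>" "\<kappa> \<le> 3 powr (- p)"
  defines "\<delta> \<equiv> min c ((2 * c) powr (1 / (p - 1)))"
  shows "\<exists>u v. \<delta> \<le> u \<and> 2 * u + \<delta> \<le> 1 \<and> \<delta> \<le> v \<and> 2 * v + \<delta> \<le> 1 \<and>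
    u powr (p - 1) * v = \<kappa> \<and> (1 - 2 * u) powr (p - 1) * (1 - 2 * v) = \<kappa>"
proof -
  define h where "h u = (1 - 2 * u) powr (p - 1) * (1 - 2 * \<kappa> / u powr (p - 1)) - \<kappa>" for u
  define u0 where "u0 = (2 * \<kappa>) powr (1 / (p - 1))"
  have k0: "0 < \<kappa>" using c \<kappa> by linarith
  have third: "(1/3 :: real) powr (p - 1) = 3 * 3 powr (- p)"
    by (simp add: powr_divide powr_diff powr_minus field_simps)
  have u0: "0 < u0" "u0 powr (p - 1) = 2 * \<kappa>" using k0 p by (simp_all add: u0_def powr_powr)
  have "u0 powr (p - 1) \<le> (1/3) powr (p - 1)" unfolding u0(2) third using \<kappa>(2) k0 by linarith
  then have u03: "u0 \<le> 1/3"
    using powr_less_mono2[of "p - 1" "1/3" u0] p by (meson diff_gt_0_iff_gt leD leI less_eq_real_def zero_le_divide_1_iff zero_le_numeral)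
  have "h u0 \<le> 0" using k0 by (simp add: h_def u0(2))
  moreover have "0 \<le> h (1/3)"
  proof -
    have "h (1/3) = 3 * 3 powr (- p) - 3 * \<kappa>"
      using third by (simp add: h_def field_simps)
    then show ?thesis using \<kappa>(2) by simp
  qed
  moreover have "continuous_on {u0..1/3} h"
    unfolding h_def[abs_def] using u0(1) p by (intro continuous_intros continuous_on_powr') auto
  ultimately obtain u where u: "u0 \<le> u" "u \<le> 1/3" "h u = 0" using IVT'[of h u0 0 "1/3"] u03 by auto
  define v where "v = \<kappa> / u powr (p - 1)"
  have up: "0 < u" using u u0 by linarith
  have 1: "u powr (p - 1) * v = \<kappa>" using up by (simp add: v_def)
  have 2: "(1 - 2 * u) powr (p - 1) * (1 - 2 * v) = \<kappa>" using u(3) by (simp add: h_def v_def)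
  \<comment> \<open>In a product equal to \<open>\<kappa>\<close> with one factor at most 1, the other factor is at least \<open>\<kappa>\<close>.\<close>
  have factor: "\<kappa> \<le> w" if "0 \<le> t" "t \<le> 1" "t powr (p - 1) * w = \<kappa>" for t w
  proof -
    have "t powr (p - 1) \<le> 1" using powr_mono2[of "p - 1" t 1] p that by simp
    moreover have "0 \<le> w" using that(3) k0 by (smt (verit) mult_nonneg_nonpos powr_ge_zero)
    ultimately show ?thesis using that(3) mult_right_mono[of "t powr (p - 1)" 1 w] by simp
  qed
  have "\<kappa> \<le> v" using factor[OF _ _ 1] up u(2) by simp
  moreover have "\<kappa> \<le> 1 - 2 * v" using factor[OF _ _ 2] up u(2) by simp
  moreover have "\<kappa> \<le> 1 / 3"
  proof -
    have "(3 :: real) powr (- p) \<le> 3 powr (- 1)" using p by (intro powr_mono) auto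
    then show ?thesis using \<kappa>(2) by (simp add: powr_minus)
  qed
  moreover have "(2 * c) powr (1 / (p - 1)) \<le> u0" unfolding u0_def using c \<kappa> p by (intro powr_mono2) auto
  ultimately show ?thesis using 1 2 u \<kappa> by (intro exI[of _ u] exI[of _ v]) (auto simp: \<delta>_def min_def)
qed

lemma powr_pull_out:
  fixes c a b p :: real
  assumes "0 < c" "0 \<le> a"
  shows "(c * a) powr (p - 1) * (c * b) = c powr p * (a powr (p - 1) * b)"
proof -
  have "c powr p = c powr (p - 1) * c" using assms(1) by (simp add: powr_diff)
  then show ?thesis using assms by (simp add: powr_mult)
qed

text \<open>
  Two cascades whose masses are balanced on every cell, together with a function \<open>\<Psi>\<close> that is
  comparable to the common value of generation \<open>n\<close> at radii between \<open>3\<^sup>-\<^sup>n\<^sup>-\<^sup>1\<close> and \<open>3\<^sup>-\<^sup>n\<close>. The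
  bound by \<open>H_le\<close> extends to larger radii, which covers balls that exhaust \<open>[0,1]\<close>.
\<close>

locale cascade_pair = U: cascade u \<delta> + V: cascade v \<delta> for u v \<delta> +
  fixes p A :: real and \<Psi> :: "real \<Rightarrow> real" and H :: "nat \<Rightarrow> real"
  assumes p: "1 < p" and A: "0 < A" and Psi_pos: "\<And>r. 0 < r \<Longrightarrow> 0 < \<Psi> r"
    and balance: "\<And>n j. j < 3 ^ n \<Longrightarrow> U.mass n j powr (p - 1) * V.mass n j = H n"
    and H_le: "\<And>n r. 1 / 3 ^ Suc n \<le> r \<Longrightarrow> H n \<le> A * \<Psi> r"
    and H_ge: "\<And>n r. 0 < r \<Longrightarrow> r \<le> 1 / 3 ^ n \<Longrightarrow> \<Psi> r \<le> A * H n"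
begin

lemma measures_upper:
  assumes x: "x \<in> {0..1}" and r: "0 < r"
  shows "measure V.law (ball01 x r) * measure U.law (ball01 x r) powr (p - 1) \<le> (3 / \<delta>) powr p * A * \<Psi> r"
proof -
  obtain n where n: "1 / 3 ^ Suc n \<le> r" "r \<le> 1 / 3 ^ n \<or> n = 0" using triadic_level[OF r] .
  obtain j where j: "real j \<le> x * 3 ^ n" "x * 3 ^ n \<le> real j + 1" "j < 3 ^ n"
    using triadic_cell[OF x] .
  have d: "0 < \<delta>" by (rule U.delta_pos)
  have V: "measure V.law (ball01 x r) \<le> 3 / \<delta> * V.mass n j"
    and U: "measure U.law (ball01 x r) \<le> 3 / \<delta> * U.mass n j"
    using V.ball_upper[OF j r n(2)] U.ball_upper[OF j r n(2)] d by (simp_all add: field_simps)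
  have "measure V.law (ball01 x r) * measure U.law (ball01 x r) powr (p - 1) \<le>
      (3 / \<delta> * V.mass n j) * (3 / \<delta> * U.mass n j) powr (p - 1)"
    using U V p d V.mass_nonneg[of n j] by (intro mult_mono powr_mono2) auto
  also have "\<dots> = (3 / \<delta>) powr p * (U.mass n j powr (p - 1) * V.mass n j)"
    using powr_pull_out[of "3 / \<delta>" "U.mass n j" p "V.mass n j"] d U.mass_nonneg by (simp add: mult.commute)
  also have "\<dots> \<le> (3 / \<delta>) powr p * (A * \<Psi> r)"
    unfolding balance[OF j(3)] by (intro mult_left_mono H_le n) auto
  finally show ?thesis by (simp add: mult.assoc)
qed

text \<open>
  The intervals of length \<open>r\<close> that matter are the two halves of the annulus around the ball. The
  estimate is stated for the reciprocal power that is the energy of a ramp across the interval.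
\<close>

lemma measures_lower:
  assumes x: "x \<in> {0..1}" and r: "0 < r" "r \<le> 1"
    and st: "0 \<le> s" "t \<le> 1" "t - s = r" "x - 2 * r \<le> s" "t \<le> x + 2 * r"
  shows "(U.cdf t - U.cdf s) powr (1 - p) \<le> A / (\<delta> ^ 6) powr p * (measure V.law (ball01 x r) / \<Psi> r)"
proof -
  obtain n where n: "1 / 3 ^ Suc n \<le> r" "r \<le> 1 / 3 ^ n \<or> n = 0" using triadic_level[OF r(1)] .
  have n': "r \<le> 1 / 3 ^ n" using n(2) r(2) by auto
  obtain j where j: "real j \<le> x * 3 ^ n" "x * 3 ^ n \<le> real j + 1" "j < 3 ^ n"
    using triadic_cell[OF x] .
  define d where "d = \<delta> ^ 6"
  have d: "0 < d" using U.delta_pos by (simp add: d_def)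
  have r2: "1 / 3 ^ (n + 2) \<le> r" using n(1) r(1) by (simp add: field_simps)
  have n2: "2 * r \<le> 2 / 3 ^ n" using n' by simp
  have U: "d * U.mass n j \<le> U.cdf t - U.cdf s"
    unfolding d_def by (rule U.cdf_lower[OF j st(1,2)]) (use st r2 n2 in linarith)+
  have V: "d * V.mass n j \<le> measure V.law (ball01 x r)"
    unfolding d_def using n(1) r by (intro V.ball_lower[OF j x]) linarith
  have pos: "0 < U.cdf t - U.cdf s" using U.cdf_strict[of s t] st r by simp
  have "d powr p * \<Psi> r \<le> d powr p * (A * H n)"
    using H_ge[OF r(1) n'] by (intro mult_left_mono) auto
  also have "\<dots> = A * ((d * U.mass n j) powr (p - 1) * (d * V.mass n j))"
    unfolding balance[OF j(3), symmetric] using d U.mass_nonneg by (simp add: powr_pull_out)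
  also have "\<dots> \<le> A * ((U.cdf t - U.cdf s) powr (p - 1) * measure V.law (ball01 x r))"
    using U V A p d U.mass_nonneg[of n j] V.mass_nonneg[of n j]
    by (intro mult_left_mono mult_mono powr_mono2) auto
  finally have "d powr p * \<Psi> r \<le> A * measure V.law (ball01 x r) * (U.cdf t - U.cdf s) powr (p - 1)"
    by (simp add: mult_ac)
  then have "d powr p * \<Psi> r / (U.cdf t - U.cdf s) powr (p - 1) \<le> A * measure V.law (ball01 x r)"
    using pos by (simp add: divide_le_eq)
  moreover have "(U.cdf t - U.cdf s) powr (1 - p) = 1 / (U.cdf t - U.cdf s) powr (p - 1)"
    using powr_minus_divide[of "U.cdf t - U.cdf s" "p - 1"] by simp
  ultimately show ?thesis
    using d Psi_pos[OF r(1)] unfolding d_def[symmetric] by (simp add: field_simps)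
qed

lemma poincare_laws: "poincare p \<Psi> U.law V.law"
  unfolding poincare_def
proof (intro exI[of _ "(3 / \<delta>) powr p * A"] conjI ballI allI impI)
  show "0 < (3 / \<delta>) powr p * A" using A U.delta_pos by simp
  fix f x r assume f: "f \<in> energy_domain p U.law" and x: "x \<in> {0..1 :: real}" and r: "0 < (r :: real)"
  let ?J = "LINT y:ball01 x r|U.law. \<bar>energy_deriv U.law f y\<bar> powr p"
  have "0 \<le> ?J" unfolding set_lebesgue_integral_def by (intro integral_nonneg_AE) auto
  then have "measure V.law (ball01 x r) * measure U.law (ball01 x r) powr (p - 1) * ?J \<le>
      (3 / \<delta>) powr p * A * \<Psi> r * ?J"
    by (intro mult_right_mono measures_upper x r)
  then show "(INF c. LINT y:ball01 x r|V.law. \<bar>f y - c\<bar> powr p) \<le> (3 / \<delta>) powr p * A * \<Psi> r * ?J"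
    by (rule order_trans[OF poincare_ball[OF U.unit_cdf_cdf V.unit_cdf_cdf f p x r]])
qed

lemma capacity_laws: "capacity_upper p \<Psi> U.law V.law"
  unfolding capacity_upper_def
proof (intro exI[of _ "2 * (A / (\<delta> ^ 6) powr p)"] conjI ballI allI impI)
  show "0 < 2 * (A / (\<delta> ^ 6) powr p)" using A U.delta_pos by simp
  fix x r :: real assume x: "x \<in> {0..1}" and r: "0 < r"
  define E where "E = A / (\<delta> ^ 6) powr p * (measure V.law (ball01 x r) / \<Psi> r)"
  have "0 \<le> E" using A Psi_pos[OF r] by (simp add: E_def)
  moreover have "(U.cdf (x - r) - U.cdf (x - 2 * r)) powr (1 - p) \<le> E" if "0 \<le> x - 2 * r"
    unfolding E_def using that x r by (intro measures_lower) auto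
  moreover have "(U.cdf (x + 2 * r) - U.cdf (x + r)) powr (1 - p) \<le> E" if "x + 2 * r \<le> 1"
    unfolding E_def using that x r by (intro measures_lower) auto
  ultimately have "\<exists>\<phi>\<in>energy_domain p U.law. (\<forall>y\<in>ball01 x r. \<phi> y = 1) \<and>
    (\<forall>y\<in>{0..1} - ball01 x (2 * r). \<phi> y = 0) \<and> energy p U.law \<phi> \<le> 2 * E"
    by (rule U.cutoff[OF p x r])
  then show "\<exists>\<phi>\<in>energy_domain p U.law. (\<forall>y\<in>ball01 x r. \<phi> y = 1) \<and>
    (\<forall>y\<in>{0..1} - ball01 x (2 * r). \<phi> y = 0) \<and>
    energy p U.law \<phi> \<le> 2 * (A / (\<delta> ^ 6) powr p) * (measure V.law (ball01 x r) / \<Psi> r)"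
    by (simp only: E_def mult.assoc)
qed

end

section \<open>The scale function at triadic scales\<close>

text \<open>
  The witness \<open>H\<close> is the smallest sequence above \<open>\<Psi>(3\<^sup>-\<^sup>n)\<close> for which \<open>3\<^sup>n\<^sup>p H n\<close> is decreasing. The
  lower scale bound with exponent at least \<open>p\<close> says that \<open>3\<^sup>n\<^sup>p \<Psi>(3\<^sup>-\<^sup>n)\<close> is decreasing up to the
  factor \<open>C\<close>, so that \<open>H\<close> exceeds \<open>\<Psi>(3\<^sup>-\<^sup>n)\<close> by at most this factor.
\<close>

lemma regularised_scale:
  fixes p C \<beta>L \<beta>U :: real
  assumes sb: "scale_bounds \<Psi> C \<beta>L \<beta>U" and C: "1 \<le> C" and p: "p \<le> \<beta>L"
    and pos: "\<And>r. 0 < r \<Longrightarrow> 0 < \<Psi> r"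
  obtains H :: "nat \<Rightarrow> real" where
    "\<And>n. \<Psi> (1 / 3 ^ n) \<le> H n" "\<And>n. H n \<le> C * \<Psi> (1 / 3 ^ n)"
    "\<And>n. H (Suc n) \<le> 3 powr (- p) * H n"
proof
  define q T where "q = (3 :: real) powr p" and "T k = q ^ k * \<Psi> (1 / 3 ^ k)" for k :: nat
  have q: "0 < q" by (simp add: q_def)
  have T: "T k \<le> C * T n" if "n \<le> k" for n k
  proof -
    obtain m where k: "k = n + m" using \<open>n \<le> k\<close> le_Suc_ex by blast
    have "inverse C * ((1 / 3 ^ n) / (1 / 3 ^ k)) powr \<beta>L \<le> \<Psi> (1 / 3 ^ n) / \<Psi> (1 / 3 ^ k)"
    proof -
      have "(1::real) / 3 ^ k \<le> 1 / 3 ^ n" using \<open>n \<le> k\<close> by (intro divide_left_mono power_increasing) auto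
      then show ?thesis using sb[unfolded scale_bounds_def, rule_format, of "1 / 3 ^ k" "1 / 3 ^ n"] by simp
    qed
    moreover have "(1 / 3 ^ n) / (1 / 3 ^ k) = (3 ^ m :: real)" by (simp add: k power_add)
    moreover have "q ^ m \<le> (3 ^ m) powr \<beta>L"
    proof -
      have "q ^ m = 3 powr (p * real m)" by (simp add: q_def powr_realpow[symmetric] powr_powr)
      also have "\<dots> \<le> 3 powr (\<beta>L * real m)" using p by (intro powr_mono mult_right_mono) auto
      also have "\<dots> = (3 ^ m) powr \<beta>L" by (simp add: powr_realpow[symmetric] powr_powr mult.commute)
      finally show ?thesis .
    qed
    ultimately have "inverse C * q ^ m \<le> \<Psi> (1 / 3 ^ n) / \<Psi> (1 / 3 ^ k)"
      using C by (smt (verit) mult_left_mono inverse_nonnegative_iff_nonnegative)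
    then have "q ^ m * \<Psi> (1 / 3 ^ k) \<le> C * \<Psi> (1 / 3 ^ n)"
      using C pos[of "1 / 3 ^ k"] by (simp add: field_simps)
    then have "q ^ n * (q ^ m * \<Psi> (1 / 3 ^ k)) \<le> q ^ n * (C * \<Psi> (1 / 3 ^ n))"
      using q by (intro mult_left_mono) auto
    then show ?thesis by (simp add: T_def k power_add mult_ac)
  qed
  have bdd: "bdd_above (T ` {n..})" for n by (rule bdd_aboveI2[of _ _ "C * T n"]) (simp add: T)
  define H where "H n = (SUP k\<in>{n..}. T k) / q ^ n" for n
  show "\<Psi> (1 / 3 ^ n) \<le> H n" for n
    using cSUP_upper[OF _ bdd, of n n] q by (simp add: H_def T_def field_simps)
  show "H n \<le> C * \<Psi> (1 / 3 ^ n)" for n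
  proof -
    have "(SUP k\<in>{n..}. T k) \<le> C * T n" by (rule cSUP_least) (auto simp: T)
    then show ?thesis using q by (simp add: H_def T_def field_simps)
  qed
  show "H (Suc n) \<le> 3 powr (- p) * H n" for n
  proof -
    have "(SUP k\<in>{Suc n..}. T k) \<le> (SUP k\<in>{n..}. T k)" by (rule cSUP_subset_mono[OF _ bdd]) auto
    then show ?thesis using q by (simp add: H_def powr_minus q_def[symmetric] field_simps)
  qed
qed

theorem theorem6p4:
  fixes p C \<beta>L \<beta>U :: real and \<Psi> :: "real \<Rightarrow> real"
  assumes "1 < p"
    and "scale_function \<Psi>"
    and "1 \<le> C" and "p \<le> \<beta>L" and "\<beta>L \<le> \<beta>U"
    and "scale_bounds \<Psi> C \<beta>L \<beta>U"
  shows "\<exists>\<nu>1 \<nu>2 :: real measure.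
      doubling01 \<nu>1 \<and> doubling01 \<nu>2 \<and>
      admissible01 \<nu>1 \<and> admissible01 \<nu>2 \<and>
      poincare p \<Psi> \<nu>1 \<nu>2 \<and> capacity_upper p \<Psi> \<nu>1 \<nu>2"
proof -
  note p = assms(1) and C = assms(3) and sb = assms(6)
  obtain \<Phi> where hom: "homeomorphism {0<..} {0<..} \<Psi> \<Phi>" and smono: "strict_mono_on {0<..} \<Psi>"
    using assms(2) by (auto simp: scale_function_def)
  have pos: "0 < \<Psi> r" if "0 < r" for r using hom that by (auto simp: homeomorphism_def)
  have mono: "\<Psi> r \<le> \<Psi> R" if "0 < r" "r \<le> R" for r R
    using smono that by (metis greaterThan_iff less_eq_real_def order_less_le_trans strict_mono_onD)
  obtain H where H: "\<And>n. \<Psi> (1 / 3 ^ n) \<le> H n" "\<And>n. H n \<le> C * \<Psi> (1 / 3 ^ n)"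
    "\<And>n. H (Suc n) \<le> 3 powr (- p) * H n"
    using regularised_scale[OF sb C assms(4) pos] by blast
  define K where "K = C * 3 powr \<beta>U"
  have K: "0 < K" using C by (simp add: K_def)
  have Hpos: "0 < H n" for n using H(1)[of n] pos[of "1 / 3 ^ n"] by simp
  \<comment> \<open>The upper scale bound keeps the ratios of consecutive values, hence all fractions, away from 0.\<close>
  have step: "\<Psi> (1 / 3 ^ n) \<le> K * \<Psi> (1 / 3 ^ Suc n)" for n
  proof -
    have "\<Psi> (1 / 3 ^ n) / \<Psi> (1 / 3 ^ Suc n) \<le> C * ((1 / 3 ^ n) / (1 / 3 ^ Suc n)) powr \<beta>U"
      using sb[unfolded scale_bounds_def, rule_format, of "1 / 3 ^ Suc n" "1 / 3 ^ n"]
      by (simp add: field_simps)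
    also have "\<dots> = K" by (simp add: K_def)
    finally show ?thesis using pos[of "1 / 3 ^ Suc n"] by (simp add: divide_le_eq)
  qed
  have H_up: "H n \<le> C * K * \<Psi> r" if "1 / 3 ^ Suc n \<le> r" for n r
  proof -
    have "H n \<le> C * \<Psi> (1 / 3 ^ n)" by (rule H(2))
    also have "\<dots> \<le> C * (K * \<Psi> (1 / 3 ^ Suc n))" using C step by (intro mult_left_mono) auto
    also have "\<dots> \<le> C * (K * \<Psi> r)" using C K that by (intro mult_left_mono mono) auto
    finally show ?thesis by (simp add: mult.assoc)
  qed
  define \<kappa> c where "\<kappa> n = H (Suc n) / H n" and "c = 1 / (C * K)" for n
  have c: "0 < c" using C K by (simp add: c_def)
  have \<kappa>_bounds: "c \<le> \<kappa> n" "\<kappa> n \<le> 3 powr (- p)" for n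
  proof -
    have "H n \<le> C * K * H (Suc n)"
      by (rule order_trans[OF H_up[OF order_refl] mult_left_mono[OF H(1)]]) (use C K in simp)
    then show "c \<le> \<kappa> n" using Hpos[of n] C K by (simp add: \<kappa>_def c_def field_simps)
    show "\<kappa> n \<le> 3 powr (- p)" using H(3)[of n] Hpos[of n] by (simp add: \<kappa>_def divide_le_eq)
  qed
  define \<delta> where "\<delta> = min c ((2 * c) powr (1 / (p - 1)))"
  obtain u v where uv: "\<And>n. \<delta> \<le> u n" "\<And>n. 2 * u n + \<delta> \<le> 1" "\<And>n. \<delta> \<le> v n" "\<And>n. 2 * v n + \<delta> \<le> 1"
    "\<And>n. u n powr (p - 1) * v n = \<kappa> n"
    "\<And>n. (1 - 2 * u n) powr (p - 1) * (1 - 2 * v n) = \<kappa> n"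
    using weights_exist[OF p c \<kappa>_bounds] unfolding \<delta>_def[symmetric] by metis
  have d: "0 < \<delta>" using c by (simp add: \<delta>_def)
  interpret U: cascade u \<delta> by unfold_locales (use d uv in auto)
  interpret V: cascade v \<delta> by unfold_locales (use d uv in auto)
  \<comment> \<open>The product telescopes along the ancestors of a cell.\<close>
  have balance: "U.mass n j powr (p - 1) * V.mass n j = H n / H 0" if "j < 3 ^ n" for n j
    using that
  proof (induction n arbitrary: j)
    case 0
    then show ?case using Hpos[of 0] by simp
  next
    case (Suc n)
    have w: "U.weight n d powr (p - 1) * V.weight n d = \<kappa> n" for d
      using uv(5,6)[of n] by (simp add: U.weight_def V.weight_def)
    have "U.mass (Suc n) j powr (p - 1) * V.mass (Suc n) j =
      (U.mass n (j div 3) powr (p - 1) * V.mass n (j div 3)) *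
      (U.weight n (j mod 3) powr (p - 1) * V.weight n (j mod 3))"
      using U.mass_nonneg U.weight_bounds(1)[of n "j mod 3"] d by (simp add: powr_mult)
    also have "\<dots> = H n / H 0 * \<kappa> n" unfolding w using Suc by (subst Suc.IH) auto
    also have "\<dots> = H (Suc n) / H 0" using Hpos[of n] by (simp add: \<kappa>_def)
    finally show ?case .
  qed
  define A where "A = max (C * K / H 0) (H 0)"
  interpret cascade_pair u v \<delta> p A \<Psi> "\<lambda>n. H n / H 0"
  proof unfold_locales
    show "0 < A" using Hpos[of 0] by (simp add: A_def)
    show "H n / H 0 \<le> A * \<Psi> r" if "1 / 3 ^ Suc n \<le> r" for n r
    proof -
      have r: "0 < r" using that by (meson less_le_trans zero_less_divide_1_iff zero_less_power zero_less_numeral)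
      have "H n / H 0 \<le> C * K / H 0 * \<Psi> r" using H_up[OF that] Hpos[of 0] by (simp add: field_simps)
      also have "\<dots> \<le> A * \<Psi> r" using pos[OF r] by (intro mult_right_mono) (auto simp: A_def)
      finally show ?thesis .
    qed
    show "\<Psi> r \<le> A * (H n / H 0)" if "0 < r" "r \<le> 1 / 3 ^ n" for n r
    proof -
      have "\<Psi> r \<le> H n" using mono[OF that] H(1)[of n] by linarith
      also have "\<dots> = H 0 * (H n / H 0)" using Hpos[of 0] by simp
      also have "\<dots> \<le> A * (H n / H 0)" using Hpos by (intro mult_right_mono) (auto simp: A_def less_imp_le)
      finally show ?thesis .
    qed
  qed (use p pos balance in auto)
  show ?thesis
    using U.doubling_law V.doubling_law U.admissible_law V.admissible_law poincare_laws capacity_laws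
    by blast
qed

end
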